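(* Let $p$, $\mathcal{A}$, $\mathcal{B}$, $\Phi$, $\hat\partial^2\Phi$ and the semismooth Newton algorithm SSN be as defined in the context. Suppose that $\mathrm{Prox}_p(\cdot)$ is strongly semismooth with respect to $\partial\mathrm{Prox}_p(\cdot)$. Let $\{(\theta^j,\xi^j)\}$ be the infinite sequence generated by Algorithm SSN with parameter $\tau\in(0,1]$. Then $\{(\theta^j,\xi^j)\}$ converges to the unique optimal solution $(\bar\theta,\bar\xi)$ of $\min_{\theta\in\mathbb{R}^n,\,\xi\in\mathbb{R}^{dn}}\Phi(\theta,\xi)$, and $$\|(\theta^{j+1},\xi^{j+1})-(\bar\theta,\bar\xi)\|=O\big(\|(\theta^j,\xi^j)-(\bar\theta,\bar\xi)\|^{1+\tau}\big).$$
   Context: Data: $X_1,\dots,X_n\in\mathbb{R}^d$, $X=(X_1,\dots,X_n)\in\mathbb{R}^{d\times n}$, $Y\in\mathbb{R}^n$, and $e_n=(1,\dots,1)^T\in\mathbb{R}^n$. The set $\mathcal{D}\subset\mathbb{R}^d$ is one of: $\{x\mid x_{K_1}\ge0,\ x_{K_2}\le0\}$ with $K_1,K_2$ disjoint subsets of $\{1,\dots,d\}$ (where $x_K$ is the sub-vector of $x$ indexed by $K$); $\{x\mid L\le x\le U\}$ with given vectors $L,U\in\mathbb{R}^d$; or $\{x\mid\|x\|_q\le L\}$ with a constant $L>0$ and $q\in\{1,2,\infty\}$. For $\xi=(\xi_1;\dots;\xi_n)\in\mathbb{R}^{dn}$ with $\xi_i\in\mathbb{R}^d$, $p(\xi)=\sum_{i=1}^n\delta_{\mathcal{D}}(\xi_i)$,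 where $\delta_{\mathcal D}$ is the indicator function ($0$ on $\mathcal D$, $+\infty$ elsewhere). $\delta_-$ is the indicator function of $\mathbb{R}^{n\times n}_-$ (matrices with nonpositive entries) and $\Pi_-$ is the projection onto it. $\mathcal{A}:\mathbb{R}^n\to\mathbb{R}^{n\times n}$ is $\mathcal{A}z=ze_n^T-e_nz^T$. With $B_i=e_nX_i^T-X^T\in\mathbb{R}^{n\times d}$, $\mathcal{B}:\mathbb{R}^{dn}\to\mathbb{R}^{n\times n}$ is $\mathcal{B}\xi=(B_1\xi_1,\dots,B_n\xi_n)$. $\mathcal{A}^*,\mathcal{B}^*$ are the adjoints (Frobenius inner product on matrices). For a closed proper convex function $f$, the Moreau envelope is $\mathrm{E}_f(x)=\min_y\{f(y)+\frac12\|y-x\|^2\}$ and $\mathrm{Prox}_f(x)$ is the unique minimizer. $\partial\mathrm{Prox}_p$ and $\partial\Pi_-$ denote the (Clarke) generalized Jacobians. For a positive definite matrix $H$, $\|x\|_H=\sqrt{\langle x,Hx\rangle}$. A locally Lipschitz map $F$ is strongly semismooth with respect to a nonempty, compact-valued, upper semicontinuous set-valued map $\mathcal K$ (whose values are sets of linear maps) if at every $x$, $F$ is directionally differentiable and, for all $V\in\mathcal{K}(x+\Delta x)$ with $\Delta x\to0$, $F(x+\Delta x)-F(x)-V\Delta x=O(\|\Delta x\|^2)$. Fix $\sigma>0$, $(\tilde\theta,\tilde\xi,\tilde u,\tilde v)\in\mathbb{R}^n\times\mathbb{R}^{dn}\times\mathbb{R}^{n\times n}\times\mathbb{R}^{dn}$,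 and positive definite matrices $H_1\in\mathbb{R}^{n\times n}$, $H_2\in\mathbb{R}^{dn\times dn}$. Define $$\Phi(\theta,\xi)=\tfrac12\|\theta-Y\|^2+\sigma\mathrm{E}_p\big(\xi-\tfrac{\tilde v}{\sigma}\big)+\sigma\mathrm{E}_{\delta_-}\big(-\mathcal{A}\theta-\mathcal{B}\xi+\tfrac{\tilde u}{\sigma}\big)-\tfrac1{2\sigma}\|\tilde u\|^2-\tfrac1{2\sigma}\|\tilde v\|^2+\tfrac1{2\sigma}\|\theta-\tilde\theta\|_{H_1}^2+\tfrac1{2\sigma}\|\xi-\tilde\xi\|_{H_2}^2 .$$ $\Phi$ is strongly convex and continuously differentiable. Define the set of linear operators on $\mathbb{R}^n\times\mathbb{R}^{dn}$ $$\hat\partial^2\Phi(\theta,\xi)=\sigma\begin{pmatrix}\mathcal{A}^*\\ \mathcal{B}^*\end{pmatrix}\Big[I-\partial\Pi_-\big(-\mathcal{A}\theta-\mathcal{B}\xi+\tfrac{\tilde u}{\sigma}\big)\Big]\begin{pmatrix}\mathcal{A}&\mathcal{B}\end{pmatrix}+\begin{pmatrix}I_n+\frac1\sigma H_1&0\\0&\sigma\big[I-\partial\mathrm{Prox}_p(\xi-\frac{\tilde v}{\sigma})\big]+\frac1\sigma H_2\end{pmatrix},$$ i.e. all operators obtained by choosing an element of each generalized Jacobian. Algorithm SSN. Given $(\theta^0,\xi^0)\in\mathbb{R}^n\times\mathbb{R}^{dn}$, $\bar\gamma\in(0,1)$, $\tau\in(0,1]$, $\delta\in(0,1)$, $\mu\in(0,1/2)$.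 For $j=0,1,2,\dots$: Step 1. Select an element $\mathcal{H}_j\in\hat\partial^2\Phi(\theta^j,\xi^j)$. Apply a direct method or the preconditioned conjugate gradient (PCG) method to find an approximate solution $(\Delta\theta^j;\Delta\xi^j)\in\mathbb{R}^n\times\mathbb{R}^{dn}$ to $\mathcal{H}_j(\Delta\theta;\Delta\xi)\approx-\nabla\Phi(\theta^j,\xi^j)$ such that $\|\mathcal{H}_j(\Delta\theta^j;\Delta\xi^j)+\nabla\Phi(\theta^j,\xi^j)\|\le\min(\bar\gamma,\|\nabla\Phi(\theta^j,\xi^j)\|^{1+\tau})$. Step 2. Set $\alpha_j=\delta^{m_j}$, where $m_j$ is the smallest nonnegative integer $m$ for which $\Phi(\theta^j+\delta^m\Delta\theta^j,\xi^j+\delta^m\Delta\xi^j)\le\Phi(\theta^j,\xi^j)+\mu\delta^m\langle\nabla\Phi(\theta^j,\xi^j),(\Delta\theta^j;\Delta\xi^j)\rangle$. Step 3. Set $\theta^{j+1}=\theta^j+\alpha_j\Delta\theta^j$, $\xi^{j+1}=\xi^j+\alpha_j\Delta\xi^j$.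
   Formalization: In Step 1 the direction is either an exact solution (direct method) or an iterate of PCG started at zero with a symmetric positive definite preconditioner, besides the residual bound; with the residual bound alone the iterates can stall at a non-optimal point. *)

theory Defs
  imports "HOL-Analysis.Analysis" "HOL-Library.Landau_Symbols"
begin

section \<open>Proximal mappings, generalized Jacobians, semismoothness\<close>

definition indicator_ext :: "'a set \<Rightarrow> 'a \<Rightarrow> ereal" where
  "indicator_ext S x = (if x \<in> S then 0 else \<infinity>)"

definition moreau_env :: "('a::real_inner \<Rightarrow> ereal) \<Rightarrow> 'a \<Rightarrow> real" where
  "moreau_env f x = real_of_ereal (INF y. f y + ereal (1/2 * (norm (y - x))\<^sup>2))"

definition Prox :: "('a::real_inner \<Rightarrow> ereal) \<Rightarrow> 'a \<Rightarrow> 'a" where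
  "Prox f x =
    (THE y. is_arg_min (\<lambda>y. f y + ereal (1/2 * (norm (y - x))\<^sup>2)) (\<lambda>_. True) y)"

text \<open>The B-subdifferential consists of the limits of Jacobians at nearby points of
  differentiability; the Clarke generalized Jacobian is its convex hull.\<close>

definition B_subdiff ::
    "('a::euclidean_space \<Rightarrow> 'b::euclidean_space) \<Rightarrow> 'a \<Rightarrow> ('a \<Rightarrow>\<^sub>L 'b) set" where
  "B_subdiff F x = {V. \<exists>s D. s \<longlonglongrightarrow> x
      \<and> (\<forall>k::nat. (F has_derivative blinfun_apply (D k)) (at (s k))) \<and> D \<longlonglongrightarrow> V}"

definition clarke_jacobian ::
    "('a::euclidean_space \<Rightarrow> 'b::euclidean_space) \<Rightarrow> 'a \<Rightarrow> ('a \<Rightarrow>\<^sub>L 'b) set" where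
  "clarke_jacobian F x = convex hull (B_subdiff F x)"

definition locally_Lipschitz :: "('a::metric_space \<Rightarrow> 'b::metric_space) \<Rightarrow> bool" where
  "locally_Lipschitz F \<longleftrightarrow> (\<forall>x. \<exists>r>0. \<exists>L. L-lipschitz_on (ball x r) F)"

definition upper_semicontinuous_map ::
    "('a::topological_space \<Rightarrow> 'b::topological_space set) \<Rightarrow> bool" where
  "upper_semicontinuous_map K \<longleftrightarrow>
    (\<forall>x U. open U \<and> K x \<subseteq> U \<longrightarrow> (\<forall>\<^sub>F y in nhds x. K y \<subseteq> U))"

definition directionally_differentiable_at ::
    "('a::real_normed_vector \<Rightarrow> 'b::real_normed_vector) \<Rightarrow> 'a \<Rightarrow> bool" where
  "directionally_differentiable_at F x \<longleftrightarrow>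
    (\<forall>h. \<exists>l. ((\<lambda>t. (F (x + t *\<^sub>R h) - F x) /\<^sub>R t) \<longlongrightarrow> l) (at_right 0))"

definition strongly_semismooth ::
    "('a::euclidean_space \<Rightarrow> 'b::euclidean_space) \<Rightarrow> ('a \<Rightarrow> ('a \<Rightarrow>\<^sub>L 'b) set) \<Rightarrow> bool" where
  "strongly_semismooth F K \<longleftrightarrow>
     locally_Lipschitz F
   \<and> (\<forall>x. K x \<noteq> {} \<and> compact (K x)) \<and> upper_semicontinuous_map K
   \<and> (\<forall>x. directionally_differentiable_at F x
        \<and> (\<exists>C. \<forall>\<^sub>F h in at 0. \<forall>V \<in> K (x + h).
              norm (F (x + h) - F x - blinfun_apply V h) \<le> C * (norm h)\<^sup>2))"


section \<open>The problem data\<close>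

text \<open>A vector of \<open>\<real>\<^sup>d\<^sup>n\<close> is indexed by \<open>'n \<times> 'd\<close>; its block \<open>\<xi>\<^sub>i\<close> collects the
  components \<open>(i, k)\<close>. The data points \<open>X\<^sub>i\<close> are the columns of \<open>X\<close>.\<close>

definition block :: "real^('n::finite \<times> 'd::finite) \<Rightarrow> 'n \<Rightarrow> real^'d" where
  "block \<xi> i = (\<chi> k. \<xi> $ (i, k))"

text \<open>The box is required to be nonempty, so that its indicator function is proper.\<close>

definition admissible_domain :: "(real^'d) set \<Rightarrow> bool" where
  "admissible_domain D \<longleftrightarrow>
     (\<exists>K1 K2. K1 \<inter> K2 = {} \<and> D = {x. (\<forall>k\<in>K1. x $ k \<ge> 0) \<and> (\<forall>k\<in>K2. x $ k \<le> 0)})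
   \<or> (\<exists>L U. (\<forall>k. L $ k \<le> U $ k) \<and> D = {x. \<forall>k. L $ k \<le> x $ k \<and> x $ k \<le> U $ k})
   \<or> (\<exists>L>0. D = {x. (\<Sum>k\<in>UNIV. \<bar>x $ k\<bar>) \<le> L} \<or> D = {x. norm x \<le> L} \<or> D = {x. infnorm x \<le> L})"

definition p_fun :: "(real^'d) set \<Rightarrow> real^('n::finite \<times> 'd::finite) \<Rightarrow> ereal" where
  "p_fun D \<xi> = (\<Sum>i\<in>UNIV. indicator_ext D (block \<xi> i))"

definition nonpos_mats :: "(real^'n^'n) set" where
  "nonpos_mats = {M. \<forall>i j. M $ i $ j \<le> 0}"

definition Pi_minus :: "real^'n^'n \<Rightarrow> real^'n^'n" where
  "Pi_minus = closest_point nonpos_mats"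

definition outer :: "real^'m \<Rightarrow> real^'n \<Rightarrow> real^'n^'m" where
  "outer a b = (\<chi> i j. a $ i * b $ j)"

definition A_op :: "real^'n \<Rightarrow> real^'n^'n" where
  "A_op z = outer z 1 - outer 1 z"

definition B_mat :: "real^'n^'d \<Rightarrow> 'n \<Rightarrow> real^'d^'n" where
  "B_mat X i = outer 1 (column i X) - transpose X"

definition B_op :: "real^'n^'d \<Rightarrow> real^('n::finite \<times> 'd::finite) \<Rightarrow> real^'n^'n" where
  "B_op X \<xi> = (\<chi> k j. (B_mat X j *v block \<xi> j) $ k)"

definition pos_def_mat :: "real^'k^'k \<Rightarrow> bool" where
  "pos_def_mat H \<longleftrightarrow> transpose H = H \<and> (\<forall>x. x \<noteq> 0 \<longrightarrow> x \<bullet> (H *v x) > 0)"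

definition norm_mat :: "real^'k^'k \<Rightarrow> real^'k \<Rightarrow> real" where
  "norm_mat H x = sqrt (x \<bullet> (H *v x))"

definition Phi ::
    "real^'n^'d \<Rightarrow> real^'n \<Rightarrow> (real^'d) set \<Rightarrow> real
     \<Rightarrow> real^'n \<Rightarrow> real^('n::finite \<times> 'd::finite) \<Rightarrow> real^'n^'n \<Rightarrow> real^('n::finite \<times> 'd::finite)
     \<Rightarrow> real^'n^'n \<Rightarrow> real^('n::finite \<times> 'd::finite)^('n::finite \<times> 'd::finite)
     \<Rightarrow> (real^'n) \<times> (real^('n::finite \<times> 'd::finite)) \<Rightarrow> real" where
  "Phi X Y D \<sigma> \<theta>' \<xi>' u v H1 H2 = (\<lambda>(\<theta>, \<xi>).
      1/2 * (norm (\<theta> - Y))\<^sup>2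
    + \<sigma> * moreau_env (p_fun D) (\<xi> - v /\<^sub>R \<sigma>)
    + \<sigma> * moreau_env (indicator_ext nonpos_mats) (- A_op \<theta> - B_op X \<xi> + u /\<^sub>R \<sigma>)
    - 1/(2*\<sigma>) * (norm u)\<^sup>2 - 1/(2*\<sigma>) * (norm v)\<^sup>2
    + 1/(2*\<sigma>) * (norm_mat H1 (\<theta> - \<theta>'))\<^sup>2
    + 1/(2*\<sigma>) * (norm_mat H2 (\<xi> - \<xi>'))\<^sup>2)"

definition hess_op ::
    "real^'n^'d \<Rightarrow> real \<Rightarrow> real^'n^'n \<Rightarrow> real^('n::finite \<times> 'd::finite)^('n::finite \<times> 'd::finite)
     \<Rightarrow> ((real^'n^'n) \<Rightarrow>\<^sub>L (real^'n^'n)) \<Rightarrow> ((real^('n::finite \<times> 'd::finite)) \<Rightarrow>\<^sub>L (real^('n::finite \<times> 'd::finite)))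
     \<Rightarrow> (real^'n) \<times> (real^('n::finite \<times> 'd::finite)) \<Rightarrow> (real^'n) \<times> (real^('n::finite \<times> 'd::finite))" where
  "hess_op X \<sigma> H1 H2 V W = (\<lambda>(h, k).
     let M = A_op h + B_op X k; R = M - blinfun_apply V M in
       (\<sigma> *\<^sub>R adjoint A_op R + (h + (H1 *v h) /\<^sub>R \<sigma>),
        \<sigma> *\<^sub>R adjoint (B_op X) R + (\<sigma> *\<^sub>R (k - blinfun_apply W k) + (H2 *v k) /\<^sub>R \<sigma>)))"

definition gen_hess_Phi ::
    "real^'n^'d \<Rightarrow> (real^'d) set \<Rightarrow> real \<Rightarrow> real^'n^'n \<Rightarrow> real^('n::finite \<times> 'd::finite)
     \<Rightarrow> real^'n^'n \<Rightarrow> real^('n::finite \<times> 'd::finite)^('n::finite \<times> 'd::finite)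
     \<Rightarrow> (real^'n) \<times> (real^('n::finite \<times> 'd::finite))
     \<Rightarrow> ((real^'n) \<times> (real^('n::finite \<times> 'd::finite)) \<Rightarrow> (real^'n) \<times> (real^('n::finite \<times> 'd::finite))) set" where
  "gen_hess_Phi X D \<sigma> u v H1 H2 = (\<lambda>(\<theta>, \<xi>).
     {hess_op X \<sigma> H1 H2 V W | V W.
        V \<in> clarke_jacobian Pi_minus (- A_op \<theta> - B_op X \<xi> + u /\<^sub>R \<sigma>)
      \<and> W \<in> clarke_jacobian (Prox (p_fun D)) (\<xi> - v /\<^sub>R \<sigma>)})"


section \<open>The semismooth Newton algorithm\<close>

definition grad :: "('a::real_inner \<Rightarrow> real) \<Rightarrow> 'a \<Rightarrow> 'a" where
  "grad f x = (THE g. GDERIV f x :> g)"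

definition pos_def_op :: "('a::real_inner \<Rightarrow> 'a) \<Rightarrow> bool" where
  "pos_def_op M \<longleftrightarrow> linear M \<and> (\<forall>x y. M x \<bullet> y = x \<bullet> M y) \<and> (\<forall>x. x \<noteq> 0 \<longrightarrow> x \<bullet> M x > 0)"

text \<open>Preconditioned conjugate gradients for \<open>A x = b\<close> with preconditioner \<open>M\<close> and
  starting point \<open>0\<close>. The state is (iterate, residual, search direction). Once the residual
  vanishes, the convention \<open>a / 0 = 0\<close> keeps the iterate constant.\<close>

primrec pcg_state ::
    "('a::real_inner \<Rightarrow> 'a) \<Rightarrow> ('a \<Rightarrow> 'a) \<Rightarrow> 'a \<Rightarrow> nat \<Rightarrow> 'a \<times> 'a \<times> 'a" where
  "pcg_state A M b 0 = (0, b, inv M b)"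
| "pcg_state A M b (Suc k) =
    (let (x, r, s) = pcg_state A M b k;
         a = (r \<bullet> inv M r) / (s \<bullet> A s);
         r' = r - a *\<^sub>R A s;
         c = (r' \<bullet> inv M r') / (r \<bullet> inv M r)
     in (x + a *\<^sub>R s, r', inv M r' + c *\<^sub>R s))"

definition pcg_iterate ::
    "('a::real_inner \<Rightarrow> 'a) \<Rightarrow> ('a \<Rightarrow> 'a) \<Rightarrow> 'a \<Rightarrow> nat \<Rightarrow> 'a" where
  "pcg_iterate A M b k = fst (pcg_state A M b k)"

text \<open>A direct method returns an exact solution; PCG may stop after any number of steps, with
  any positive definite preconditioner. The residual tolerance alone would not force
  the result to be a direction of sufficient descent.\<close>

definition linear_solver_output ::
    "('a::real_inner \<Rightarrow> 'a) \<Rightarrow> 'a \<Rightarrow> 'a \<Rightarrow> bool" where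
  "linear_solver_output A b x \<longleftrightarrow>
     A x = b \<or> (\<exists>M k. pos_def_op M \<and> x = pcg_iterate A M b k)"

definition newton_direction ::
    "('a::real_inner \<Rightarrow> real) \<Rightarrow> ('a \<Rightarrow> ('a \<Rightarrow> 'a) set) \<Rightarrow> real \<Rightarrow> real \<Rightarrow> 'a \<Rightarrow> 'a \<Rightarrow> bool" where
  "newton_direction f K \<gamma> \<tau> z d \<longleftrightarrow>
     (\<exists>H \<in> K z. linear_solver_output H (- grad f z) d
        \<and> norm (H d + grad f z) \<le> min \<gamma> (norm (grad f z) powr (1 + \<tau>)))"

definition armijo :: "('a::real_inner \<Rightarrow> real) \<Rightarrow> real \<Rightarrow> real \<Rightarrow> 'a \<Rightarrow> 'a \<Rightarrow> nat \<Rightarrow> bool" where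
  "armijo f \<mu> \<delta> z d m \<longleftrightarrow> f (z + \<delta> ^ m *\<^sub>R d) \<le> f z + \<mu> * \<delta> ^ m * (grad f z \<bullet> d)"

definition ssn_sequence ::
    "('a::real_inner \<Rightarrow> real) \<Rightarrow> ('a \<Rightarrow> ('a \<Rightarrow> 'a) set) \<Rightarrow> real \<Rightarrow> real \<Rightarrow> real \<Rightarrow> real
     \<Rightarrow> (nat \<Rightarrow> 'a) \<Rightarrow> bool" where
  "ssn_sequence f K \<gamma> \<tau> \<delta> \<mu> z \<longleftrightarrow>
     (\<forall>j. \<exists>d m. newton_direction f K \<gamma> \<tau> (z j) d
        \<and> armijo f \<mu> \<delta> (z j) d m \<and> (\<forall>m'<m. \<not> armijo f \<mu> \<delta> (z j) d m')
        \<and> z (Suc j) = z j + \<delta> ^ m *\<^sub>R d)"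

end

theory Submission
  imports Defs
begin

text \<open>The gradient of \<open>\<Phi>\<close> is \<open>S z + c + \<sigma> T\<^sup>*(I - \<Pi>)(T z + a)\<close> with \<open>S\<close> symmetric positive definite,
  \<open>T(\<theta>, \<xi>) = (- \<A>\<theta> - \<B>\<xi>, \<xi>)\<close> and \<open>\<Pi> = (\<Pi>\<^sub>-, Prox\<^sub>p)\<close> a projection, so it is Lipschitz and strongly
  monotone, and the generalized Hessians are symmetric with uniform positive bounds from below and
  above.

  Global convergence: a conjugate gradient iterate \<open>d\<close> for \<open>H d = b\<close> is orthogonal to its residual,
  whatever the preconditioner, so \<open>\<langle>b, d\<rangle> = \<langle>d, H d\<rangle> \<ge> m \<parallel>d\<parallel>\<^sup>2\<close>; the residual tolerance bounds \<open>\<parallel>d\<parallel>\<close> below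
  by a multiple of \<open>\<parallel>b\<parallel>\<close>. Hence the Armijo steps are bounded away from zero and every step decreases
  \<open>\<Phi>\<close> by at least a multiple of \<open>\<parallel>\<nabla>\<Phi>\<parallel>\<^sup>2\<close>.

  Local rate: strong semismoothness gives \<open>\<parallel>z + d - zbar\<parallel> = O(\<parallel>z - zbar\<parallel>\<^bsup>1+\<tau>\<^esup>)\<close> for the full Newton step.
  Since \<open>\<Pi>\<close> is Lipschitz and directionally differentiable, it is uniformly almost positively
  homogeneous around each point, which yields
  \<open>\<Phi>(z) - \<Phi>(zbar) = 1/2 \<langle>\<nabla>\<Phi>(z), z - zbar\<rangle> + o(\<parallel>z - zbar\<parallel>\<^sup>2)\<close>; as \<open>\<mu> < 1/2\<close>, the full step is eventually
  accepted.\<close>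

section \<open>Preconditioned conjugate gradients\<close>

text \<open>Positivity makes \<open>M\<close> injective, hence bijective in finite dimension, so
  \<open>inv M\<close> is a genuine inverse and inner products with \<open>inv M\<close> can be
  rewritten as inner products with \<open>M\<close>.\<close>

lemma pos_def_op_inv:
  fixes M :: "'a::euclidean_space \<Rightarrow> 'a"
  assumes "pos_def_op M"
  shows "pos_def_op (inv M)"
proof -
  have lin: "linear M" and sym: "\<And>x y. M x \<bullet> y = x \<bullet> M y" and pos: "\<And>x. x \<noteq> 0 \<Longrightarrow> x \<bullet> M x > 0"
    using assms unfolding pos_def_op_def by auto
  have "inj M"
    unfolding linear_injective_0[OF lin] using pos by (metis inner_zero_right less_irrefl)
  then have "surj M"
    using lin by (simp add: linear_injective_imp_surjective)
  then have MI: "M (inv M y) = y" for y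
    by (simp add: surj_f_inv_f)
  show ?thesis
    unfolding pos_def_op_def
  proof (intro conjI allI impI)
    show "linear (inv M)"
      using lin \<open>inj M\<close> \<open>surj M\<close> by (simp add: linear_inj_imp_surj inj_linear_imp_inv_linear)
    show "inv M x \<bullet> y = x \<bullet> inv M y" for x y
      using sym[of "inv M x" "inv M y"] by (simp add: MI)
    show "x \<bullet> inv M x > 0" if "x \<noteq> 0" for x
      using pos[of "inv M x"] that linear_0[OF lin] by (metis MI inner_commute)
  qed
qed

text \<open>A conjugate gradient iterate lies in the span of the search directions, to which its residual
  is orthogonal.\<close>

lemma pcg_iterate_orthogonal_residual:
  fixes A M :: "'a::euclidean_space \<Rightarrow> 'a"
  assumes A: "pos_def_op A" and M: "pos_def_op M"
  shows "pcg_iterate A M b k \<bullet> (b - A (pcg_iterate A M b k)) = 0"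
proof -
  define P where "P = inv M"
  define x where "x k = fst (pcg_state A M b k)" for k
  define r where "r k = fst (snd (pcg_state A M b k))" for k
  define s where "s k = snd (snd (pcg_state A M b k))" for k
  define a where "a k = (r k \<bullet> P (r k)) / (s k \<bullet> A (s k))" for k
  define c where "c k = (r (Suc k) \<bullet> P (r (Suc k))) / (r k \<bullet> P (r k))" for k
  have linA: "linear A" and symA: "\<And>x y. A x \<bullet> y = x \<bullet> A y"
    and posA: "\<And>x. x \<noteq> 0 \<Longrightarrow> x \<bullet> A x > 0"
    using A unfolding pos_def_op_def by auto
  have linP: "linear P" and symP: "\<And>x y. P x \<bullet> y = x \<bullet> P y"
    and posP: "\<And>x. x \<noteq> 0 \<Longrightarrow> x \<bullet> P x > 0"
    using pos_def_op_inv[OF M] unfolding pos_def_op_def P_def by auto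
  have P0: "P 0 = 0" and A0: "A 0 = 0"
    using linP linA linear_0 by auto
  have x0: "x 0 = 0" and r0: "r 0 = b" and s0: "s 0 = P b"
    by (auto simp: x_def r_def s_def P_def)
  have xS: "x (Suc k) = x k + a k *\<^sub>R s k"
    and rS: "r (Suc k) = r k - a k *\<^sub>R A (s k)"
    and sS: "s (Suc k) = P (r (Suc k)) + c k *\<^sub>R s k" for k
    by (auto simp: x_def r_def s_def P_def a_def c_def Let_def case_prod_beta)
  have rs: "r k \<bullet> s k = r k \<bullet> P (r k)"
    and s_zero: "r k = 0 \<longleftrightarrow> s k = 0"
    and rSs: "r (Suc k) \<bullet> s k = 0" for k
  proof -
    \<comment> \<open>The three claims need a joint induction: the recursion for
      \<open>s (Suc k)\<close> uses orthogonality at \<open>k\<close>, and the equivalence ensures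
      that the denominator of the step length vanishes only when the residual does.\<close>
    have "r k \<bullet> s k = r k \<bullet> P (r k) \<and> (r k = 0 \<longleftrightarrow> s k = 0) \<and> r (Suc k) \<bullet> s k = 0"
    proof (induction k)
      case 0
      have "b = 0 \<longleftrightarrow> P b = 0"
        using posP[of b] P0 by force
      moreover have "(b \<bullet> P b / (P b \<bullet> A (P b))) * (A (P b) \<bullet> P b) = b \<bullet> P b"
        using posA[of "P b"] calculation by (auto simp: inner_commute)
      ultimately show ?case
        by (auto simp: r0 s0 rS a_def inner_diff_left)
    next
      case (Suc k)
      have 1: "r (Suc k) \<bullet> s (Suc k) = r (Suc k) \<bullet> P (r (Suc k))"
        using Suc by (simp add: sS inner_add_right)
      have 2: "r (Suc k) = 0 \<longleftrightarrow> s (Suc k) = 0"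
      proof
        show "s (Suc k) = 0" if "r (Suc k) = 0"
          using that by (simp add: sS c_def P0)
        show "r (Suc k) = 0" if "s (Suc k) = 0"
          using that posP[of "r (Suc k)"] 1 by force
      qed
      have "r (Suc (Suc k)) \<bullet> s (Suc k) = 0"
        using 1 2 posA[of "s (Suc k)"]
        by (cases "s (Suc k) = 0") (auto simp: rS[of "Suc k"] a_def inner_diff_left symA)
      with 1 2 show ?case by blast
    qed
    then show "r k \<bullet> s k = r k \<bullet> P (r k)" "r k = 0 \<longleftrightarrow> s k = 0" "r (Suc k) \<bullet> s k = 0"
      by auto
  qed
  \<comment> \<open>Before termination the step length is nonzero, which permits division by
    \<open>a i\<close> when \<open>A (s i)\<close> is expressed through consecutive
    residuals.\<close>
  have a_zero: "a k = 0 \<longleftrightarrow> s k = 0" for k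
    using posP[of "r k"] posA[of "s k"] s_zero[of k] by (auto simp: a_def)
  \<comment> \<open>Residuals are orthogonal to all earlier directions and directions are conjugate
    for \<open>A\<close>; each half of this invariant is needed to extend the other.\<close>
  have orth: "\<forall>i<k. r k \<bullet> s i = 0 \<and> s k \<bullet> A (s i) = 0" for k
  proof (induction k)
    case (Suc k)
    have r_s: "r (Suc k) \<bullet> s i = 0" if "i < Suc k" for i
      using Suc that rSs[of k] symA[of "s k" "s i"]
      by (cases "i = k") (auto simp: rS inner_diff_left)
    have r_P: "r (Suc k) \<bullet> P (r i) = 0" if "i < Suc k" for i
    proof (cases i)
      case 0
      then show ?thesis using r_s[of 0] by (simp add: s0 r0)
    next
      case (Suc l)
      then have "P (r i) = s i - c l *\<^sub>R s l"
        by (simp add: sS)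
      then show ?thesis using r_s that Suc by (simp add: inner_diff_right)
    qed
    have "s (Suc k) \<bullet> A (s i) = 0" if "i < Suc k" for i
    proof (cases "s i = 0")
      case False
      then have A_s: "A (s i) = (1 / a i) *\<^sub>R (r i - r (Suc i))"
        using a_zero[of i] by (simp add: rS)
      have Pr: "P (r (Suc k)) \<bullet> A (s i) = - (r (Suc k) \<bullet> P (r (Suc i))) / a i"
        using r_P[OF that] by (simp add: A_s symP inner_diff_right linear_diff[OF linP] linear_scale[OF linP])
      \<comment> \<open>For the latest direction the coefficient \<open>c k\<close> is built to
        cancel the term in \<open>Pr\<close>; for earlier directions both contributions vanish
        separately.\<close>
      show ?thesis
      proof (cases "i = k")
        case True
        have "s k \<bullet> A (s k) > 0" "r k \<bullet> P (r k) > 0"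
          using posA posP False s_zero[of k] True by auto
        then have "c k * (s k \<bullet> A (s k)) = (r (Suc k) \<bullet> P (r (Suc k))) / a k"
          by (simp add: c_def a_def field_simps)
        then show ?thesis
          using Pr True by (simp add: sS[of k] inner_add_left)
      next
        case i: False
        then have "i < k" using that by simp
        then show ?thesis
          using Pr Suc r_P[of "Suc i"] by (simp add: sS[of k] inner_add_left)
      qed
    qed (simp add: A0)
    with r_s show ?case by blast
  qed simp
  have span: "y \<bullet> x k = 0" if "\<forall>i<k. y \<bullet> s i = 0" for y k
    using that by (induction k) (auto simp: x0 xS inner_add_right)
  have "r k = b - A (x k)"
    by (induction k) (auto simp: x0 xS r0 rS A0 linear_add[OF linA] linear_scale[OF linA])
  moreover have "r k \<bullet> x k = 0"
    using span orth by blast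
  ultimately show ?thesis
    by (simp add: pcg_iterate_def x_def inner_commute)
qed


section \<open>Gradients\<close>

text \<open>Uniqueness of gradients justifies the definite description in \<open>grad\<close>: two
  candidates agree once tested on their own difference.\<close>

lemma grad_eq:
  assumes "GDERIV f x :> g"
  shows "grad f x = g"
proof -
  have "g' = g" if "GDERIV f x :> g'" for g'
  proof -
    have "(\<lambda>h. h \<bullet> g') = (\<lambda>h. h \<bullet> g)"
      using has_derivative_unique assms that unfolding gderiv_def by blast
    then have "(g' - g) \<bullet> g' = (g' - g) \<bullet> g"
      by metis
    then show ?thesis
      by (metis eq_iff_diff_eq_0 inner_diff_right inner_eq_zero_iff)
  qed
  then show ?thesis
    using assms unfolding grad_def by blast
qed

lemma GDERIV_line:
  assumes "\<And>y. GDERIV f y :> G y"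
  shows "((\<lambda>t. f (x + t *\<^sub>R h)) has_real_derivative G (x + t *\<^sub>R h) \<bullet> h) (at t)"
proof -
  have "(f has_derivative (\<lambda>k. k \<bullet> G (x + t *\<^sub>R h))) (at (x + t *\<^sub>R h))"
    using assms unfolding gderiv_def by blast
  then have "((\<lambda>t. f (x + t *\<^sub>R h)) has_derivative (\<lambda>t'. (t' *\<^sub>R h) \<bullet> G (x + t *\<^sub>R h))) (at t)"
    by (rule has_derivative_compose[rotated]) (auto intro!: derivative_eq_intros)
  then show ?thesis
    unfolding has_field_derivative_def by (simp add: inner_commute mult_commute_abs)
qed

lemma GDERIV_mvt:
  assumes "\<And>y. GDERIV f y :> G y"
  obtains s where "0 < s" "s < 1" "f (x + h) - f x = G (x + s *\<^sub>R h) \<bullet> h"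
proof -
  have "\<exists>s>0. s < 1 \<and> f (x + 1 *\<^sub>R h) - f (x + 0 *\<^sub>R h) = (1 - 0) * (G (x + s *\<^sub>R h) \<bullet> h)"
    by (rule MVT2) (auto intro: GDERIV_line assms)
  then show ?thesis
    using that by auto
qed


section \<open>Semismooth Newton method for strongly monotone gradients\<close>

text \<open>The two branches of the minimum cross at \<open>s\<close>, where the power equals
  \<open>\<gamma>\<close>; the line through the origin and this crossing point, of slope
  \<open>s powr \<tau>\<close>, dominates both. This turns the residual tolerance into a relative
  error with a factor below 1.\<close>

lemma min_powr_le_linear:
  fixes \<gamma> \<tau> :: real
  assumes "0 < \<gamma>" "\<gamma> < 1" "0 < \<tau>"
  obtains \<rho> where "\<rho> < 1" "\<And>t. t \<ge> 0 \<Longrightarrow> min \<gamma> (t powr (1 + \<tau>)) \<le> \<rho> * t"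
proof
  define s where "s = \<gamma> powr (1 / (1 + \<tau>))"
  have s: "0 < s" "s powr (1 + \<tau>) = \<gamma>"
    using assms by (auto simp: s_def powr_powr)
  have sl: "s < 1"
    using s assms ge_one_powr_ge_zero[of s "1 + \<tau>"] by force
  show "s powr \<tau> < 1"
    using s sl assms by (simp add: powr01_less_one)
  fix t :: real assume t: "t \<ge> 0"
  show "min \<gamma> (t powr (1 + \<tau>)) \<le> s powr \<tau> * t"
  proof (cases "t \<le> s")
    case True
    have "t powr (1 + \<tau>) = t powr \<tau> * t"
      using t by (simp add: powr_add)
    also have "\<dots> \<le> s powr \<tau> * t"
      using t True assms by (intro mult_right_mono powr_mono2) auto
    finally show ?thesis by simp
  next
    case False
    have "\<gamma> = s powr \<tau> * s"
      using s by (simp add: powr_add mult.commute)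
    also have "\<dots> \<le> s powr \<tau> * t"
      using False by (intro mult_left_mono) auto
    finally show ?thesis by simp
  qed
qed

text \<open>Collects what the convergence proof uses about a gradient \<open>G\<close> and a family
  \<open>K\<close> of generalized Hessians, with common constants \<open>m\<close> and
  \<open>L\<close>. The assumption \<open>radial\<close> says that increments of \<open>G\<close>
  are positively homogeneous up to o(norm h), uniformly along the segment; it stands in for
  differentiability of \<open>G\<close>.\<close>

locale semismooth_newton =
  fixes f :: "'a::euclidean_space \<Rightarrow> real" and G :: "'a \<Rightarrow> 'a"
    and K :: "'a \<Rightarrow> ('a \<Rightarrow> 'a) set" and m L :: real
  assumes gderiv: "GDERIV f x :> G x"
    and m_pos: "m > 0"
    and strong_mono: "m * (norm (x - y))\<^sup>2 \<le> (G x - G y) \<bullet> (x - y)"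
    and Lipschitz: "norm (G x - G y) \<le> L * norm (x - y)"
    and K_linear: "H \<in> K x \<Longrightarrow> linear H"
    and K_sym: "H \<in> K x \<Longrightarrow> H y \<bullet> z = y \<bullet> H z"
    and K_pos: "H \<in> K x \<Longrightarrow> m * (norm y)\<^sup>2 \<le> H y \<bullet> y"
    and K_bounded: "H \<in> K x \<Longrightarrow> norm (H y) \<le> L * norm y"
    and semismooth: "\<exists>C. \<forall>\<^sub>F h in nhds 0. \<forall>H\<in>K (x + h).
        norm (G (x + h) - G x - H h) \<le> C * (norm h)\<^sup>2"
    and radial: "\<epsilon> > 0 \<Longrightarrow> \<forall>\<^sub>F h in nhds 0. \<forall>t\<in>{0..1}.
        norm (G (x + t *\<^sub>R h) - G x - t *\<^sub>R (G (x + h) - G x)) \<le> \<epsilon> * norm h"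
begin

section \<open>Quadratic bounds and the unique minimizer\<close>

lemma m_le_L: "m \<le> L" and L_pos: "L > 0"
proof -
  obtain b :: 'a where b: "norm b = 1"
    using nonempty_Basis norm_Basis by blast
  have "m \<le> (G b - G 0) \<bullet> b"
    using strong_mono[of b 0] b by simp
  also have "\<dots> \<le> norm (G b - G 0)"
    using norm_cauchy_schwarz[of "G b - G 0" b] b by simp
  also have "\<dots> \<le> L"
    using Lipschitz[of b 0] b by simp
  finally show "m \<le> L" .
  then show "L > 0" using m_pos by simp
qed

lemma grad_f: "grad f x = G x"
  using gderiv by (rule grad_eq)

text \<open>A single mean value point gives the constant \<open>L\<close> instead of the sharper L /
  2 of an integral argument, which is enough for both line search estimates.\<close>

lemma descent_bound: "f (x + h) \<le> f x + G x \<bullet> h + L * (norm h)\<^sup>2"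
proof -
  obtain s where s: "0 < s" "s < 1" "f (x + h) - f x = G (x + s *\<^sub>R h) \<bullet> h"
    using GDERIV_mvt[OF gderiv] by blast
  have "norm (G (x + s *\<^sub>R h) - G x) \<le> L * (s * norm h)"
    using Lipschitz[of "x + s *\<^sub>R h" x] s by simp
  also have "\<dots> \<le> L * norm h"
    using s L_pos by (simp add: mult_left_le_one_le)
  finally have "(G (x + s *\<^sub>R h) - G x) \<bullet> h \<le> L * norm h * norm h"
    by (meson norm_cauchy_schwarz mult_right_mono norm_ge_zero order_trans)
  then show ?thesis
    using s(3) by (simp add: inner_diff_left power2_eq_square)
qed

text \<open>A gradient step of suitable length is a contraction: expand the square, then insert
  strong monotonicity and the Lipschitz bound. Its fixed point is a zero of
  \<open>G\<close>.\<close>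

lemma G_zero_exists: "\<exists>z. G z = 0"
proof -
  \<comment> \<open>The choice of \<open>t\<close> minimizes 1 - 2 t m + t^2 L^2, and
    \<open>q\<close> is the square root of the minimum, which \<open>m_le_L\<close> shows to be
    nonnegative.\<close>
  define t where "t = m / L\<^sup>2"
  define q where "q = sqrt (1 - m\<^sup>2 / L\<^sup>2)"
  have mL: "m\<^sup>2 / L\<^sup>2 \<le> 1" "0 < m\<^sup>2 / L\<^sup>2"
    using m_pos m_le_L L_pos by (auto intro: power_mono)
  have "\<exists>!z. z - t *\<^sub>R G z = z"
  proof (rule banach_fix_type[of q])
    show "0 \<le> q" "q < 1"
      using mL by (auto simp: q_def)
    show "\<forall>x y. dist (x - t *\<^sub>R G x) (y - t *\<^sub>R G y) \<le> q * dist x y"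
    proof (intro allI)
      fix x y
      have expand: "(norm (u - t *\<^sub>R w))\<^sup>2 = (norm u)\<^sup>2 - 2 * t * (w \<bullet> u) + t\<^sup>2 * (norm w)\<^sup>2" for u w :: 'a
        unfolding power2_norm_eq_inner
        by (simp add: inner_diff_left inner_diff_right inner_commute power2_eq_square)
      have "(norm (x - t *\<^sub>R G x - (y - t *\<^sub>R G y)))\<^sup>2 = (norm ((x - y) - t *\<^sub>R (G x - G y)))\<^sup>2"
        by (simp add: algebra_simps)
      also have "\<dots> = (norm (x - y))\<^sup>2 - 2 * t * ((G x - G y) \<bullet> (x - y)) + t\<^sup>2 * (norm (G x - G y))\<^sup>2"
        by (rule expand)
      also have "\<dots> \<le> (norm (x - y))\<^sup>2 - 2 * t * (m * (norm (x - y))\<^sup>2) + t\<^sup>2 * (L * norm (x - y))\<^sup>2"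
        using strong_mono[of x y] Lipschitz[of x y] m_pos
        by (intro add_mono diff_mono mult_left_mono power_mono) (auto simp: t_def)
      also have "\<dots> = (q * norm (x - y))\<^sup>2"
        using mL L_pos by (simp add: q_def t_def power_mult_distrib field_simps power2_eq_square power4_eq_xxxx)
      finally show "dist (x - t *\<^sub>R G x) (y - t *\<^sub>R G y) \<le> q * dist x y"
        using \<open>0 \<le> q\<close> by (auto simp: dist_norm intro: power2_le_imp_le)
    qed
  qed
  then show ?thesis
    using m_pos L_pos by (auto simp: t_def)
qed

text \<open>At the mean value point the displacement from \<open>z\<close> is a positive multiple of
  \<open>y - z\<close>, so strong monotonicity makes the slope positive.\<close>

lemma G_zero_strict_min:
  assumes "G z = 0" "y \<noteq> z"
  shows "f z < f y"
proof -
  obtain s where s: "0 < s" "s < 1" "f (z + (y - z)) - f z = G (z + s *\<^sub>R (y - z)) \<bullet> (y - z)"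
    using GDERIV_mvt[OF gderiv] by blast
  have "0 < m * (norm (s *\<^sub>R (y - z)))\<^sup>2"
    using m_pos s assms by simp
  also have "\<dots> \<le> s * (G (z + s *\<^sub>R (y - z)) \<bullet> (y - z))"
    using strong_mono[of "z + s *\<^sub>R (y - z)" z] assms by simp
  finally show ?thesis
    using s by (simp add: zero_less_mult_iff)
qed

lemma is_arg_min_iff:
  assumes "G z = 0"
  shows "is_arg_min f (\<lambda>_. True) y \<longleftrightarrow> y = z"
  using G_zero_strict_min[OF assms] unfolding is_arg_min_def
  by (metis less_asym')

lemma norm_le_norm_G:
  assumes "G z = 0"
  shows "m * norm (x - z) \<le> norm (G x)"
proof (cases "x = z")
  case False
  have "m * (norm (x - z))\<^sup>2 \<le> norm (G x) * norm (x - z)"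
    using strong_mono[of x z] norm_cauchy_schwarz[of "G x" "x - z"] assms by simp
  then show ?thesis
    using False by (simp add: power2_eq_square)
qed simp

section \<open>Newton directions and global convergence\<close>

text \<open>Both kinds of solver output are orthogonal to their residual: an exact solution because
  the residual is zero, a conjugate gradient iterate by
  \<open>pcg_iterate_orthogonal_residual\<close>. This identity turns positivity of \<open>H\<close>
  into descent.\<close>

lemma newton_direction_inner:
  assumes "newton_direction f K \<gamma> \<tau> z d"
  obtains H where "H \<in> K z" "norm (H d + G z) \<le> min \<gamma> (norm (G z) powr (1 + \<tau>))"
    "H d \<bullet> d = - (G z \<bullet> d)"
proof -
  obtain H where H: "H \<in> K z" "linear_solver_output H (- G z) d"
      "norm (H d + G z) \<le> min \<gamma> (norm (G z) powr (1 + \<tau>))"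
    using assms unfolding newton_direction_def grad_f by blast
  have "pos_def_op H"
    unfolding pos_def_op_def
  proof (intro conjI allI impI)
    fix x :: 'a assume "x \<noteq> 0"
    then have "0 < m * (norm x)\<^sup>2" using m_pos by simp
    then show "x \<bullet> H x > 0" using K_pos[OF H(1), of x] by (simp add: inner_commute)
  qed (use K_linear[OF H(1)] K_sym[OF H(1)] in auto)
  then have "d \<bullet> (- G z - H d) = 0"
    using H(2) pcg_iterate_orthogonal_residual unfolding linear_solver_output_def by auto
  then have "H d \<bullet> d = - (G z \<bullet> d)"
    by (simp add: inner_diff_right inner_commute)
  with H that show ?thesis by blast
qed

lemma newton_direction_descent:
  assumes "newton_direction f K \<gamma> \<tau> z d"
  shows "m * (norm d)\<^sup>2 \<le> - (G z \<bullet> d)"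
  using newton_direction_inner[OF assms] K_pos by metis

text \<open>The relative residual is bounded by a factor below 1, so the direction cannot be short
  compared with the gradient, and all short steps pass the Armijo test, so the accepted step has a
  floor. The constant is uniform in \<open>z\<close>, \<open>d\<close> and \<open>k\<close>.\<close>

lemma sufficient_decrease:
  assumes "0 < \<gamma>" "\<gamma> < 1" "0 < \<tau>" "0 < \<delta>" "\<delta> < 1" "0 < \<mu>" "\<mu> < 1"
  obtains c where "c > 0"
    "\<And>z d k. newton_direction f K \<gamma> \<tau> z d \<Longrightarrow> armijo f \<mu> \<delta> z d k \<Longrightarrow>
      \<forall>k'<k. \<not> armijo f \<mu> \<delta> z d k' \<Longrightarrow> f (z + \<delta> ^ k *\<^sub>R d) \<le> f z - c * (norm (G z))\<^sup>2"
proof -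
  obtain \<rho> where \<rho>: "\<rho> < 1" "\<And>t. t \<ge> 0 \<Longrightarrow> min \<gamma> (t powr (1 + \<tau>)) \<le> \<rho> * t"
    using min_powr_le_linear assms by blast
  \<comment> \<open>\<open>c1\<close> bounds the slope, because \<open>norm d\<close> will be at
    least (1 - \<open>\<rho>\<close>) / L times the gradient norm. Step lengths up to (1 -
    \<open>\<mu>\<close>) m / L pass the test, and backtracking undershoots this threshold by at
    most one factor \<open>\<delta>\<close>; the minimum with 1 covers immediate acceptance.\<close>
  define c1 where "c1 = m * ((1 - \<rho>) / L)\<^sup>2"
  define t0 where "t0 = min 1 (\<delta> * ((1 - \<mu>) * m / L))"
  have c1: "c1 > 0" using \<rho> m_pos L_pos by (simp add: c1_def)
  have t0: "t0 > 0" using assms m_pos L_pos by (simp add: t0_def)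
  show ?thesis
  proof (rule that[of "\<mu> * t0 * c1"])
    show "\<mu> * t0 * c1 > 0" using c1 t0 assms by simp
    fix z d k
    assume d: "newton_direction f K \<gamma> \<tau> z d" and k: "armijo f \<mu> \<delta> z d k"
      and k': "\<forall>k'<k. \<not> armijo f \<mu> \<delta> z d k'"
    obtain H where H: "H \<in> K z" "norm (H d + G z) \<le> min \<gamma> (norm (G z) powr (1 + \<tau>))"
      using newton_direction_inner[OF d] by blast
    have "norm (H d + G z) \<le> \<rho> * norm (G z)"
      using H(2) \<rho>(2)[OF norm_ge_zero] by (rule order_trans)
    then have "(1 - \<rho>) * norm (G z) \<le> norm (H d)"
      using norm_triangle_ineq4[of "H d + G z" "H d"] by (simp add: left_diff_distrib)
    also have "\<dots> \<le> L * norm d"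
      using K_bounded[OF H(1)] .
    finally have "(1 - \<rho>) / L * norm (G z) \<le> norm d"
      using L_pos by (simp add: field_simps)
    then have "((1 - \<rho>) / L * norm (G z))\<^sup>2 \<le> (norm d)\<^sup>2"
      using \<rho>(1) L_pos by (intro power_mono) auto
    then have "m * ((1 - \<rho>) / L * norm (G z))\<^sup>2 \<le> m * (norm d)\<^sup>2"
      using m_pos by (intro mult_left_mono) auto
    then have "c1 * (norm (G z))\<^sup>2 \<le> m * (norm d)\<^sup>2"
      by (simp only: c1_def power_mult_distrib mult.assoc)
    then have desc: "c1 * (norm (G z))\<^sup>2 \<le> - (G z \<bullet> d)"
      using newton_direction_descent[OF d] by simp
    have "t0 \<le> \<delta> ^ k"
    proof (cases k)
      case 0
      then show ?thesis by (simp add: t0_def)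
    next
      case (Suc l)
      \<comment> \<open>The exponent just before the accepted one failed the test, whereas
        \<open>descent_bound\<close> lets every step up to the threshold succeed.\<close>
      have "\<not> t \<le> (1 - \<mu>) * m / L" if t: "t = \<delta> ^ l" for t
      proof
        assume le: "t \<le> (1 - \<mu>) * m / L"
        have tp: "t > 0" using t assms by simp
        have "L * t \<le> (1 - \<mu>) * m"
          using le L_pos by (simp add: field_simps)
        then have "L * t * (norm d)\<^sup>2 \<le> (1 - \<mu>) * m * (norm d)\<^sup>2"
          by (intro mult_right_mono) auto
        also have "\<dots> = (1 - \<mu>) * (m * (norm d)\<^sup>2)"
          by simp
        also have "\<dots> \<le> (1 - \<mu>) * - (G z \<bullet> d)"
          using newton_direction_descent[OF d] assms by (intro mult_left_mono) auto
        finally have "t * (L * t * (norm d)\<^sup>2) \<le> t * ((1 - \<mu>) * - (G z \<bullet> d))"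
          using tp by (intro mult_left_mono) auto
        then have "armijo f \<mu> \<delta> z d l"
          using descent_bound[of z "t *\<^sub>R d"] tp unfolding armijo_def grad_f t[symmetric]
          by (simp add: power2_eq_square algebra_simps)
        then show False using k' Suc by simp
      qed
      then have "(1 - \<mu>) * m / L \<le> \<delta> ^ l" by force
      then have "\<delta> * ((1 - \<mu>) * m / L) \<le> \<delta> ^ k"
        using Suc assms by (simp only: power_Suc mult_left_mono less_imp_le)
      then show ?thesis by (simp add: t0_def)
    qed
    then have "\<mu> * t0 * (c1 * (norm (G z))\<^sup>2) \<le> \<mu> * \<delta> ^ k * - (G z \<bullet> d)"
      using desc c1 t0 assms by (intro mult_mono) auto
    then show "f (z + \<delta> ^ k *\<^sub>R d) \<le> f z - \<mu> * t0 * c1 * (norm (G z))\<^sup>2"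
      using k unfolding armijo_def grad_f by (simp add: mult.assoc)
  qed
qed

text \<open>The decreases telescope and \<open>f\<close> is bounded below by \<open>f zb\<close>, so
  the squared gradient norms are summable; \<open>norm_le_norm_G\<close> converts vanishing
  gradients into convergence of the whole sequence.\<close>

lemma ssn_convergent:
  assumes "0 < \<gamma>" "\<gamma> < 1" "0 < \<tau>" "0 < \<delta>" "\<delta> < 1" "0 < \<mu>" "\<mu> < 1"
    and seq: "ssn_sequence f K \<gamma> \<tau> \<delta> \<mu> z" and zb: "G zb = 0"
  shows "z \<longlonglongrightarrow> zb"
proof -
  obtain c where c: "c > 0"
    "\<And>z d k. newton_direction f K \<gamma> \<tau> z d \<Longrightarrow> armijo f \<mu> \<delta> z d k \<Longrightarrow>
      \<forall>k'<k. \<not> armijo f \<mu> \<delta> z d k' \<Longrightarrow> f (z + \<delta> ^ k *\<^sub>R d) \<le> f z - c * (norm (G z))\<^sup>2"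
    using sufficient_decrease[OF assms(1-7)] by blast
  have dec: "c * (norm (G (z j)))\<^sup>2 \<le> f (z j) - f (z (Suc j))" for j
    using seq c(2) unfolding ssn_sequence_def by (metis le_diff_eq add.commute diff_add_cancel add_le_cancel_left)
  have "(\<Sum>j<n. c * (norm (G (z j)))\<^sup>2) \<le> f (z 0) - f zb" for n
  proof -
    have "(\<Sum>j<n. c * (norm (G (z j)))\<^sup>2) \<le> (\<Sum>j<n. f (z j) - f (z (Suc j)))"
      by (intro sum_mono dec)
    also have "\<dots> = f (z 0) - f (z n)"
      by (rule sum_lessThan_telescope')
    also have "\<dots> \<le> f (z 0) - f zb"
      using G_zero_strict_min[OF zb, of "z n"] by force
    finally show ?thesis .
  qed
  then have "summable (\<lambda>j. c * (norm (G (z j)))\<^sup>2)"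
    using c(1) by (intro summableI_nonneg_bounded) auto
  then have "(\<lambda>j. c * (norm (G (z j)))\<^sup>2) \<longlonglongrightarrow> 0"
    by (rule summable_LIMSEQ_zero)
  then have "(\<lambda>j. (1 / c) * (c * (norm (G (z j)))\<^sup>2)) \<longlonglongrightarrow> 0"
    by (rule tendsto_mult_right_zero)
  then have "(\<lambda>j. (norm (G (z j)))\<^sup>2) \<longlonglongrightarrow> 0"
    using c(1) by simp
  then have "(\<lambda>j. sqrt ((norm (G (z j)))\<^sup>2)) \<longlonglongrightarrow> sqrt 0"
    by (rule tendsto_real_sqrt)
  then have G0: "(\<lambda>j. norm (G (z j)) / m) \<longlonglongrightarrow> 0"
    using tendsto_divide_zero by (simp add: real_sqrt_abs)
  have "(\<lambda>j. norm (z j - zb)) \<longlonglongrightarrow> 0"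
    by (rule Lim_null_comparison[OF _ G0])
      (use norm_le_norm_G[OF zb] m_pos in \<open>auto simp: field_simps intro!: always_eventually\<close>)
  then show ?thesis
    by (simp add: LIM_zero_iff tendsto_norm_zero_iff)
qed

section \<open>Local rate and acceptance of the full step\<close>

text \<open>Applying \<open>H\<close> to the error after the full step leaves the residual of the
  linear solve minus the semismoothness remainder. The former has order 1 + \<open>\<tau>\<close> by
  the tolerance, the latter is quadratic, and the lower bound for \<open>H\<close> then removes
  \<open>H\<close>.\<close>

lemma newton_step_superlinear:
  assumes "0 < \<tau>" "\<tau> \<le> 1" and zb: "G zb = 0"
  obtains C where "C > 0" "\<forall>\<^sub>F z in nhds zb. \<forall>d. newton_direction f K \<gamma> \<tau> z d \<longrightarrow>
    norm (z + d - zb) \<le> C * norm (z - zb) powr (1 + \<tau>)"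
proof -
  obtain C0 where C0: "\<forall>\<^sub>F h in nhds 0. \<forall>H\<in>K (zb + h).
        norm (G (zb + h) - G zb - H h) \<le> C0 * (norm h)\<^sup>2"
    using semismooth by blast
  define C where "C = (L powr (1 + \<tau>) + \<bar>C0\<bar>) / m"
  have "filterlim (\<lambda>z. z - zb) (nhds (zb - zb)) (nhds zb)"
    by (intro tendsto_diff filterlim_ident tendsto_const)
  then have lim: "filterlim (\<lambda>z. z - zb) (nhds 0) (nhds zb)" by simp
  \<comment> \<open>Within distance 1 the square of the error is at most its power 1 +
    \<open>\<tau>\<close>, as \<open>\<tau>\<close> is at most 1; this merges the two error
    orders.\<close>
  have near: "\<forall>\<^sub>F z in nhds zb. norm (z - zb) < 1"
    using eventually_nhds_metric[of _ zb] by (auto simp: dist_norm intro!: exI[of _ 1])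
  have "\<forall>\<^sub>F z in nhds zb. \<forall>d. newton_direction f K \<gamma> \<tau> z d \<longrightarrow>
    norm (z + d - zb) \<le> C * norm (z - zb) powr (1 + \<tau>)"
    using near lim[unfolded filterlim_iff, rule_format, OF C0]
  proof eventually_elim
    case (elim z)
    show ?case
    proof (intro allI impI)
      fix d assume "newton_direction f K \<gamma> \<tau> z d"
      then obtain H where H: "H \<in> K z" "norm (H d + G z) \<le> norm (G z) powr (1 + \<tau>)"
        by (meson newton_direction_inner min.boundedE)
      define e where "e = norm (z - zb)"
      have "norm (H d + G z) \<le> (L * e) powr (1 + \<tau>)"
        using H(2) Lipschitz[of z zb] zb assms(1)
        by (smt (verit) e_def diff_zero norm_ge_zero powr_mono2)
      also have "\<dots> = L powr (1 + \<tau>) * e powr (1 + \<tau>)"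
        using L_pos by (simp add: e_def powr_mult)
      finally have 1: "norm (H d + G z) \<le> L powr (1 + \<tau>) * e powr (1 + \<tau>)" .
      have "norm (G z - H (z - zb)) \<le> C0 * e\<^sup>2"
        using elim H(1) zb by (auto simp: e_def)
      also have "\<dots> \<le> \<bar>C0\<bar> * e\<^sup>2"
        by (intro mult_right_mono) auto
      also have "\<dots> = \<bar>C0\<bar> * e powr 2"
        by (simp add: e_def powr_numeral)
      also have "\<dots> \<le> \<bar>C0\<bar> * e powr (1 + \<tau>)"
      proof (cases "e = 0")
        case False
        then have "0 < e" "e < 1" using elim by (auto simp: e_def)
        then show ?thesis using assms by (intro mult_left_mono powr_mono') auto
      qed simp
      finally have 2: "norm (G z - H (z - zb)) \<le> \<bar>C0\<bar> * e powr (1 + \<tau>)" .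
      have "H (z + d - zb) = (H d + G z) - (G z - H (z - zb))"
        using K_linear[OF H(1)] by (simp add: linear_add linear_diff)
      then have "norm (H (z + d - zb)) \<le> norm (H d + G z) + norm (G z - H (z - zb))"
        by (metis norm_triangle_ineq4)
      also have "\<dots> \<le> (L powr (1 + \<tau>) + \<bar>C0\<bar>) * e powr (1 + \<tau>)"
        using 1 2 by (simp add: distrib_right)
      also have "\<dots> = m * C * e powr (1 + \<tau>)"
        using m_pos by (simp add: C_def)
      finally have ub: "norm (H (z + d - zb)) \<le> m * C * e powr (1 + \<tau>)" .
      define w where "w = z + d - zb"
      have "m * norm w * norm w \<le> norm (H w) * norm w"
        using K_pos[OF H(1), of w] norm_cauchy_schwarz[of "H w" w]
        by (simp add: power2_eq_square mult.assoc)
      then have "m * norm w \<le> norm (H w)"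
        by (cases "w = 0") auto
      with ub have "m * norm w \<le> m * (C * e powr (1 + \<tau>))"
        by (simp add: w_def mult.assoc)
      then show "norm (z + d - zb) \<le> C * norm (z - zb) powr (1 + \<tau>)"
        using m_pos by (simp add: w_def e_def)
    qed
  qed
  moreover have "C > 0"
    using L_pos m_pos by (simp add: C_def add_pos_nonneg)
  ultimately show ?thesis using that by blast
qed

text \<open>The mean value form of the error is controlled by \<open>radial\<close>; no second-order Taylor
  expansion of \<open>f\<close> is available.\<close>

lemma half_slope_expansion:
  assumes zb: "G zb = 0" and "\<epsilon> > 0"
  shows "\<forall>\<^sub>F h in nhds 0. \<bar>f (zb + h) - f zb - 1/2 * (G (zb + h) \<bullet> h)\<bar> \<le> \<epsilon> * (norm h)\<^sup>2"
  using radial[of \<epsilon> zb, OF \<open>\<epsilon> > 0\<close>]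
proof eventually_elim
  case (elim h)
  \<comment> \<open>The increment of \<open>\<phi>\<close> from 0 to 1 is exactly the error to be
    bounded, and its derivative is the radial defect of \<open>G\<close> paired with
    \<open>h\<close>.\<close>
  define \<phi> where "\<phi> t = f (zb + t *\<^sub>R h) - t\<^sup>2 / 2 * (G (zb + h) \<bullet> h)" for t
  define \<phi>' where "\<phi>' t = G (zb + t *\<^sub>R h) \<bullet> h - t * (G (zb + h) \<bullet> h)" for t
  have "(\<phi> has_real_derivative \<phi>' t) (at t)" for t
    unfolding \<phi>_def \<phi>'_def by (auto intro!: derivative_eq_intros GDERIV_line[OF gderiv])
  then have "\<exists>s>0. s < 1 \<and> \<phi> 1 - \<phi> 0 = (1 - 0) * \<phi>' s"
    by (intro MVT2) auto
  then obtain s where s: "0 < s" "s < 1" "\<phi> 1 - \<phi> 0 = \<phi>' s" by auto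
  have "\<bar>\<phi>' s\<bar> = \<bar>(G (zb + s *\<^sub>R h) - s *\<^sub>R G (zb + h)) \<bullet> h\<bar>"
    by (simp add: \<phi>'_def inner_diff_left)
  also have "\<dots> \<le> norm (G (zb + s *\<^sub>R h) - s *\<^sub>R G (zb + h)) * norm h"
    by (rule Cauchy_Schwarz_ineq2)
  also have "\<dots> \<le> (\<epsilon> * norm h) * norm h"
    using elim s zb by (intro mult_right_mono) (auto dest!: bspec[of _ _ s])
  finally show ?case
    using s(3) by (simp add: \<phi>_def power2_eq_square)
qed

text \<open>Near \<open>zb\<close> the value \<open>f z\<close> exceeds the minimum by about q / 2
  with q = \<open>G z \<bullet> (z - zb)\<close>, the full step attains the minimum up to a small
  multiple of the squared error, and its slope is about -q. The Armijo inequality thus reduces to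
  \<open>\<mu>\<close> < 1/2, with room for the errors.\<close>

lemma eventually_unit_step:
  assumes "0 < \<tau>" "\<tau> \<le> 1" "0 < \<mu>" "\<mu> < 1/2" and zb: "G zb = 0"
  shows "\<forall>\<^sub>F z in nhds zb. \<forall>d. newton_direction f K \<gamma> \<tau> z d \<longrightarrow> armijo f \<mu> \<delta> z d 0"
proof -
  obtain C where C: "C > 0" "\<forall>\<^sub>F z in nhds zb. \<forall>d. newton_direction f K \<gamma> \<tau> z d \<longrightarrow>
    norm (z + d - zb) \<le> C * norm (z - zb) powr (1 + \<tau>)"
    using newton_step_superlinear[OF assms(1,2) zb] by blast
  \<comment> \<open>The facts \<open>up\<close>, \<open>low\<close> and \<open>mu\<close> below each
    lose \<open>\<epsilon>\<close> e^2; the divisor 3 fits these losses into (1/2 -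
    \<open>\<mu>\<close>) m e^2. The bound \<open>\<eta>\<close> on the ratio of new to old error
    satisfies \<open>L * \<eta> \<le> \<epsilon>\<close>, and \<open>\<eta> \<le> 1\<close> lets its
    square obey the same estimate.\<close>
  define \<epsilon> where "\<epsilon> = (1/2 - \<mu>) * m / 3"
  define \<eta> where "\<eta> = min 1 (\<epsilon> / L)"
  have \<epsilon>: "\<epsilon> > 0" using assms m_pos by (simp add: \<epsilon>_def)
  have \<eta>: "\<eta> > 0" "\<eta> \<le> 1" "L * \<eta> \<le> \<epsilon>"
    using \<epsilon> L_pos by (auto simp: \<eta>_def min_def field_simps)
  have lim: "filterlim (\<lambda>z. z - zb) (nhds 0) (nhds zb)"
    using tendsto_diff[OF filterlim_ident tendsto_const, of zb zb] by simp
  have "((\<lambda>z. norm (z - zb) powr \<tau>) \<longlongrightarrow> 0) (nhds zb)"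
    using tendsto_norm[OF lim] assms(1) by (intro tendsto_zero_powrI[where b = \<tau>]) auto
  then have "\<forall>\<^sub>F z in nhds zb. norm (z - zb) powr \<tau> < \<eta> / C"
    using \<eta> C by (intro order_tendstoD) auto
  then show ?thesis
    using C(2) lim[unfolded filterlim_iff, rule_format, OF half_slope_expansion[OF zb \<epsilon>]]
  proof eventually_elim
    case (elim z)
    show ?case
    proof (intro allI impI)
      fix d assume d: "newton_direction f K \<gamma> \<tau> z d"
      define e where "e = norm (z - zb)"
      define w where "w = z + d - zb"
      have "norm w \<le> C * (e powr \<tau> * e)"
        using elim(2) d by (simp add: w_def e_def powr_add mult.commute)
      also have "\<dots> \<le> C * (\<eta> / C * e)"
        using elim(1) C by (intro mult_left_mono mult_right_mono) (auto simp: e_def)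
      finally have w: "norm w \<le> \<eta> * e"
        using C by simp
      define q where "q = G z \<bullet> (z - zb)"
      have q: "m * e\<^sup>2 \<le> q"
        using strong_mono[of z zb] zb by (simp add: q_def e_def)
      have "(norm w)\<^sup>2 \<le> (\<eta> * e)\<^sup>2"
        using w by (intro power_mono) auto
      also have "\<dots> = \<eta> * (\<eta> * e\<^sup>2)"
        by (simp add: power2_eq_square)
      also have "\<dots> \<le> \<eta> * e\<^sup>2"
        using \<eta> by (intro mult_left_le_one_le) auto
      finally have "L * (norm w)\<^sup>2 \<le> L * \<eta> * e\<^sup>2"
        using L_pos by (simp add: mult.assoc)
      also have "\<dots> \<le> \<epsilon> * e\<^sup>2"
        using \<eta> by (intro mult_right_mono) auto
      finally have Lw: "L * (norm w)\<^sup>2 \<le> \<epsilon> * e\<^sup>2" .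
      have up: "f (z + d) \<le> f zb + \<epsilon> * e\<^sup>2"
        using descent_bound[of zb w] zb Lw by (simp add: w_def)
      have low: "1/2 * q - \<epsilon> * e\<^sup>2 \<le> f z - f zb"
        using elim(3) by (auto simp: q_def e_def abs_le_iff)
      have "- (G z \<bullet> w) \<le> norm (G z) * norm w"
        using Cauchy_Schwarz_ineq2[of "G z" w] by simp
      also have "\<dots> \<le> (L * e) * (\<eta> * e)"
        using Lipschitz[of z zb] zb w L_pos by (intro mult_mono) (auto simp: e_def)
      also have "\<dots> = (L * \<eta>) * e\<^sup>2"
        by (simp add: power2_eq_square)
      also have "\<dots> \<le> \<epsilon> * e\<^sup>2"
        using \<eta> by (intro mult_right_mono) auto
      finally have "- (G z \<bullet> d) \<le> q + \<epsilon> * e\<^sup>2"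
        by (simp add: w_def q_def inner_diff_right inner_add_right)
      then have "\<mu> * - (G z \<bullet> d) \<le> \<mu> * (q + \<epsilon> * e\<^sup>2)"
        using assms by (intro mult_left_mono) auto
      also have "\<dots> \<le> \<mu> * q + \<epsilon> * e\<^sup>2"
        using assms \<epsilon> mult_right_mono[of \<mu> 1 "\<epsilon> * e\<^sup>2"] by (simp add: algebra_simps)
      finally have mu: "- (\<mu> * (G z \<bullet> d)) \<le> \<mu> * q + \<epsilon> * e\<^sup>2"
        by simp
      have "3 * (\<epsilon> * e\<^sup>2) = (1/2 - \<mu>) * (m * e\<^sup>2)"
        by (simp add: \<epsilon>_def)
      also have "\<dots> \<le> (1/2 - \<mu>) * q"
        using q assms by (intro mult_left_mono) auto
      finally have "3 * (\<epsilon> * e\<^sup>2) \<le> 1/2 * q - \<mu> * q"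
        by (simp add: algebra_simps)
      with up low mu show "armijo f \<mu> \<delta> z d 0"
        unfolding armijo_def grad_f by simp
    qed
  qed
qed

theorem ssn_superlinear:
  assumes par: "0 < \<gamma>" "\<gamma> < 1" "0 < \<tau>" "\<tau> \<le> 1" "0 < \<delta>" "\<delta> < 1" "0 < \<mu>" "\<mu> < 1/2"
    and seq: "ssn_sequence f K \<gamma> \<tau> \<delta> \<mu> z"
  shows "\<exists>zb. (\<forall>y. is_arg_min f (\<lambda>_. True) y \<longleftrightarrow> y = zb) \<and> z \<longlonglongrightarrow> zb
    \<and> (\<lambda>j. norm (z (Suc j) - zb)) \<in> O(\<lambda>j. norm (z j - zb) powr (1 + \<tau>))"
proof -
  obtain zb where zb: "G zb = 0" using G_zero_exists by blast
  have lim: "z \<longlonglongrightarrow> zb"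
    using ssn_convergent[OF par(1-3,5-7) _ seq zb] par by simp
  obtain C where C: "\<forall>\<^sub>F z in nhds zb. \<forall>d. newton_direction f K \<gamma> \<tau> z d \<longrightarrow>
    norm (z + d - zb) \<le> C * norm (z - zb) powr (1 + \<tau>)"
    using newton_step_superlinear[OF par(3,4) zb] by blast
  have "\<forall>\<^sub>F j in sequentially. norm (z (Suc j) - zb) \<le> C * norm (z j - zb) powr (1 + \<tau>)"
    using lim[unfolded filterlim_iff, rule_format, OF C]
      lim[unfolded filterlim_iff, rule_format, 
        OF eventually_unit_step[OF par(3,4,7,8) zb, of \<gamma> \<delta>]]
  proof eventually_elim
    case (elim j)
    obtain d k where dk: "newton_direction f K \<gamma> \<tau> (z j) d" "\<forall>k'<k. \<not> armijo f \<mu> \<delta> (z j) d k'"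
        "z (Suc j) = z j + \<delta> ^ k *\<^sub>R d"
      using seq unfolding ssn_sequence_def by blast
    \<comment> \<open>Exponent 0 already passes the test, so minimality excludes backtracking and
      the next iterate is the full Newton step.\<close>
    with elim have "k = 0" by blast
    with dk elim show ?case by simp
  qed
  then have "(\<lambda>j. norm (z (Suc j) - zb)) \<in> O(\<lambda>j. norm (z j - zb) powr (1 + \<tau>))"
    by (intro bigoI[of _ C]) simp
  with lim is_arg_min_iff[OF zb] show ?thesis by blast
qed

end

section \<open>Gradients combining a linear map with a nonexpansive map\<close>

text \<open>Nonexpansiveness of \<open>p\<close> makes the identity minus \<open>p\<close> monotone,
  so the composite term preserves the strong monotonicity supplied by \<open>S\<close>. The other
  properties pass through \<open>T\<close> and its adjoint with operator norms as factors;
  \<open>S\<close> and \<open>c\<close> cancel in the semismoothness and radial defects.\<close>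

lemma semismooth_newton_composite:
  fixes S :: "'a::euclidean_space \<Rightarrow> 'a" and T :: "'a \<Rightarrow> 'b::euclidean_space"
    and p :: "'b \<Rightarrow> 'b" and U :: "'b \<Rightarrow> ('b \<Rightarrow> 'b) set"
  assumes S: "linear S" "\<And>x y. S x \<bullet> y = x \<bullet> S y" "\<And>x. m * (norm x)\<^sup>2 \<le> S x \<bullet> x" and m: "m > 0"
    and T: "linear T" and \<sigma>: "\<sigma> > 0"
    and f: "\<And>x. GDERIV f x :> S x + c + \<sigma> *\<^sub>R adjoint T (T x + a - p (T x + a))"
    and p: "\<And>x y. norm (p x - p y) \<le> norm (x - y)"
    and U: "\<And>V x. V \<in> U x \<Longrightarrow> linear V" "\<And>V x y z. V \<in> U x \<Longrightarrow> V y \<bullet> z = y \<bullet> V z"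
      "\<And>V x y. V \<in> U x \<Longrightarrow> norm (V y) \<le> norm y"
    and semis: "\<And>x. \<exists>C. \<forall>\<^sub>F h in nhds 0. \<forall>V\<in>U (x + h). norm (p (x + h) - p x - V h) \<le> C * (norm h)\<^sup>2"
    and rad: "\<And>x e. e > 0 \<Longrightarrow> \<forall>\<^sub>F h in nhds 0. \<forall>t\<in>{0..1}.
        norm (p (x + t *\<^sub>R h) - p x - t *\<^sub>R (p (x + h) - p x)) \<le> e * norm h"
  shows "\<exists>L. semismooth_newton f (\<lambda>x. S x + c + \<sigma> *\<^sub>R adjoint T (T x + a - p (T x + a)))
    (\<lambda>x. {\<lambda>h. S h + \<sigma> *\<^sub>R adjoint T (T h - V (T h)) | V. V \<in> U (T x + a)}) m L"
proof -
  define T' where "T' = adjoint T"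
  have adj: "T' y \<bullet> x = y \<bullet> T x" "x \<bullet> T' y = T x \<bullet> y" for x y
    using adjoint_works[OF T, of x y] by (auto simp: T'_def inner_commute)
  have linT': "linear T'" unfolding T'_def by (rule adjoint_linear[OF T])
  obtain BS where BS: "BS > 0" "\<And>x. norm (S x) \<le> BS * norm x"
    using linear_bounded_pos[OF S(1)] by blast
  obtain BT where BT: "BT > 0" "\<And>x. norm (T x) \<le> BT * norm x"
    using linear_bounded_pos[OF T] by blast
  obtain BT' where BT': "BT' > 0" "\<And>x. norm (T' x) \<le> BT' * norm x"
    using linear_bounded_pos[OF linT'] by blast
  \<comment> \<open>The factor 2 estimates \<open>T h - w\<close> for any \<open>w\<close> no longer
    than \<open>T h\<close>; this one bound serves both the increments of the gradient and the
    elements of \<open>K\<close>.\<close>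
  define L where "L = BS + \<sigma> * (BT' * (2 * BT))"
  define G where "G x = S x + c + \<sigma> *\<^sub>R T' (T x + a - p (T x + a))" for x
  define K where "K x = {\<lambda>h. S h + \<sigma> *\<^sub>R T' (T h - V (T h)) | V. V \<in> U (T x + a)}" for x
  have G_diff: "G x - G y = S (x - y) + \<sigma> *\<^sub>R T' (T (x - y) - (p (T x + a) - p (T y + a)))" for x y
    by (simp add: G_def linear_diff[OF linT'] linear_diff[OF T] linear_diff[OF S(1)] linear_add[OF linT']
        algebra_simps)
  have bound: "norm (S h + \<sigma> *\<^sub>R T' (T h - w)) \<le> L * norm h" if "norm w \<le> norm (T h)" for h w
  proof -
    have "norm (T h - w) \<le> 2 * norm (T h)"
      using norm_triangle_ineq4[of "T h" w] that by simp
    also have "\<dots> \<le> 2 * (BT * norm h)"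
      using BT by simp
    finally have "norm (T' (T h - w)) \<le> BT' * (2 * (BT * norm h))"
      using BT'(1) by (intro order_trans[OF BT'(2)] mult_left_mono) auto
    then have "norm (\<sigma> *\<^sub>R T' (T h - w)) \<le> \<sigma> * (BT' * (2 * (BT * norm h)))"
      using \<sigma> by simp
    then have "norm (S h + \<sigma> *\<^sub>R T' (T h - w)) \<le> BS * norm h + \<sigma> * (BT' * (2 * (BT * norm h)))"
      using BS by (intro norm_triangle_le add_mono) auto
    then show ?thesis by (simp add: L_def algebra_simps)
  qed
  \<comment> \<open>Pulls the neighbourhood statements about \<open>p\<close> back along
    \<open>T\<close>.\<close>
  have T_lim: "filterlim T (nhds 0) (nhds 0)"
    using linear_continuous_at[of T 0] T linear_0[OF T]
    by (simp add: continuous_at linear_conv_bounded_linear tendsto_nhds_iff)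
  have K: "linear H" "\<And>y z. H y \<bullet> z = y \<bullet> H z" "\<And>y. m * (norm y)\<^sup>2 \<le> H y \<bullet> y"
      "\<And>y. norm (H y) \<le> L * norm y" if "H \<in> K x" for H x
  proof -
    from that obtain V where V: "V \<in> U (T x + a)" and H: "H = (\<lambda>h. S h + \<sigma> *\<^sub>R T' (T h - V (T h)))"
      unfolding K_def by blast
    note linV = U(1)[OF V]
    show "linear H"
      unfolding H
      by (intro linear_compose_add S(1) linear_compose_scale_right linear_compose[OF _ linT', unfolded o_def]
          linear_compose_sub T linear_compose[OF T linV, unfolded o_def])
    show "H y \<bullet> z = y \<bullet> H z" for y z
      by (simp add: H inner_add_left inner_add_right adj S(2) inner_diff_left inner_diff_right U(2)[OF V])
    show "m * (norm y)\<^sup>2 \<le> H y \<bullet> y" for y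
    proof -
      have "V (T y) \<bullet> T y \<le> norm (T y) * norm (T y)"
        using norm_cauchy_schwarz U(3)[OF V, of "T y"] by (meson mult_right_mono norm_ge_zero order_trans)
      then have "0 \<le> \<sigma> * ((T y - V (T y)) \<bullet> T y)"
        using \<sigma> by (simp add: inner_diff_left power2_norm_eq_inner flip: power2_eq_square)
      then show ?thesis
        using S(3)[of y] by (simp add: H inner_add_left adj)
    qed
    show "norm (H y) \<le> L * norm y" for y
      unfolding H by (intro bound U(3)[OF V])
  qed
  have "semismooth_newton f G K m L"
  proof (rule semismooth_newton.intro)
    show "GDERIV f x :> G x" for x
      using f[of x] by (simp add: G_def T'_def)
    show "m * (norm (x - y))\<^sup>2 \<le> (G x - G y) \<bullet> (x - y)" for x y
    proof -
      define w where "w = p (T x + a) - p (T y + a)"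
      have "w \<bullet> T (x - y) \<le> norm w * norm (T (x - y))"
        by (rule norm_cauchy_schwarz)
      also have "\<dots> \<le> norm (T (x - y)) * norm (T (x - y))"
        using p[of "T x + a" "T y + a"] by (intro mult_right_mono) (auto simp: w_def linear_diff[OF T])
      finally have "0 \<le> \<sigma> * ((T (x - y) - w) \<bullet> T (x - y))"
        using \<sigma> by (simp add: inner_diff_left power2_norm_eq_inner flip: power2_eq_square)
      then show ?thesis
        using S(3)[of "x - y"] unfolding G_diff w_def[symmetric] by (simp add: inner_add_left adj)
    qed
    show "norm (G x - G y) \<le> L * norm (x - y)" for x y
      unfolding G_diff using p[of "T x + a" "T y + a"] by (intro bound) (simp add: linear_diff[OF T])
    show "linear H" "H y \<bullet> z = y \<bullet> H z" "m * (norm y)\<^sup>2 \<le> H y \<bullet> y" "norm (H y) \<le> L * norm y"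
      if "H \<in> K x" for H x y z
      using K[OF that] by auto
  next
    fix x
    obtain C where C: "\<forall>\<^sub>F h in nhds 0. \<forall>V\<in>U (T x + a + h).
        norm (p (T x + a + h) - p (T x + a) - V h) \<le> C * (norm h)\<^sup>2"
      using semis by blast
    have "\<forall>\<^sub>F h in nhds 0. \<forall>H\<in>K (x + h).
        norm (G (x + h) - G x - H h) \<le> (\<sigma> * (BT' * (\<bar>C\<bar> * BT\<^sup>2))) * (norm h)\<^sup>2"
      using T_lim[unfolded filterlim_iff, rule_format, OF C]
    proof eventually_elim
      case (elim h)
      show ?case
      proof
        fix H assume "H \<in> K (x + h)"
        then obtain V where V: "V \<in> U (T x + a + T h)" and H: "H = (\<lambda>h. S h + \<sigma> *\<^sub>R T' (T h - V (T h)))"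
          unfolding K_def by (auto simp: linear_add[OF T] algebra_simps)
        define r where "r = p (T x + a + T h) - p (T x + a) - V (T h)"
        have "norm r \<le> C * (norm (T h))\<^sup>2"
          using elim V by (simp add: r_def)
        also have "\<dots> \<le> \<bar>C\<bar> * (BT * norm h)\<^sup>2"
          using BT by (intro mult_mono power_mono) auto
        finally have "norm (T' r) \<le> BT' * (\<bar>C\<bar> * (BT * norm h)\<^sup>2)"
          using BT'(1) by (intro order_trans[OF BT'(2)] mult_left_mono) auto
        moreover have "G (x + h) - G x - H h = - (\<sigma> *\<^sub>R T' r)"
          unfolding G_diff
          by (simp add: H r_def linear_diff[OF linT'] linear_add[OF linT'] linear_add[OF T] algebra_simps)
        ultimately show "norm (G (x + h) - G x - H h) \<le> (\<sigma> * (BT' * (\<bar>C\<bar> * BT\<^sup>2))) * (norm h)\<^sup>2"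
          using \<sigma> by (simp add: power_mult_distrib mult.assoc)
      qed
    qed
    then show "\<exists>C. \<forall>\<^sub>F h in nhds 0. \<forall>H\<in>K (x + h). norm (G (x + h) - G x - H h) \<le> C * (norm h)\<^sup>2"
      by blast
  next
    fix e :: real and x assume e: "e > 0"
    \<comment> \<open>Compensates in advance for the factors \<open>\<sigma>\<close>,
      \<open>BT'\<close> and \<open>BT\<close> lost on the way from \<open>p\<close> to the
      gradient.\<close>
    define e' where "e' = e / (\<sigma> * (BT' * BT))"
    have e': "e' > 0" "\<sigma> * (BT' * (e' * BT)) = e"
      using e \<sigma> BT(1) BT'(1) by (auto simp: e'_def)
    show "\<forall>\<^sub>F h in nhds 0. \<forall>t\<in>{0..1}.
        norm (G (x + t *\<^sub>R h) - G x - t *\<^sub>R (G (x + h) - G x)) \<le> e * norm h"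
      using T_lim[unfolded filterlim_iff, rule_format, OF rad[OF e'(1), of "T x + a"]]
    proof eventually_elim
      case (elim h)
      show ?case
      proof
        fix t :: real assume t: "t \<in> {0..1}"
        define r where "r = p (T x + a + t *\<^sub>R T h) - p (T x + a) - t *\<^sub>R (p (T x + a + T h) - p (T x + a))"
        have "norm r \<le> e' * norm (T h)"
          using elim t by (simp add: r_def)
        also have "\<dots> \<le> e' * (BT * norm h)"
          using BT e' by (intro mult_left_mono) auto
        finally have "norm (T' r) \<le> BT' * (e' * (BT * norm h))"
          using BT'(1) by (intro order_trans[OF BT'(2)] mult_left_mono) auto
        moreover have "G (x + t *\<^sub>R h) - G x - t *\<^sub>R (G (x + h) - G x) = - (\<sigma> *\<^sub>R T' r)"
          unfolding G_diff
          by (simp add: r_def linear_diff[OF linT'] linear_add[OF linT'] linear_add[OF T] linear_scale[OF T] linear_scale[OF linT']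
              linear_scale[OF S(1)] algebra_simps)
        ultimately have "norm (G (x + t *\<^sub>R h) - G x - t *\<^sub>R (G (x + h) - G x))
            \<le> \<sigma> * (BT' * (e' * (BT * norm h)))"
          using \<sigma> by simp
        also have "\<dots> = e * norm h"
          using e'(2) by (simp flip: mult.assoc)
        finally show "norm (G (x + t *\<^sub>R h) - G x - t *\<^sub>R (G (x + h) - G x)) \<le> e * norm h" .
      qed
    qed
  qed (rule m)
  then show ?thesis
    unfolding G_def[abs_def] K_def[abs_def] T'_def by blast
qed


section \<open>Projections\<close>

lemma has_derivative_directional:
  assumes "(F has_derivative D) (at x)"
  shows "((\<lambda>t. (F (x + t *\<^sub>R h) - F x) /\<^sub>R t) \<longlongrightarrow> D h) (at_right 0)"
proof -
  have lin: "linear D"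
    using assms has_derivative_linear by blast
  have "((\<lambda>t. x + t *\<^sub>R h) has_derivative (\<lambda>t. t *\<^sub>R h)) (at_right 0)"
    by (auto intro!: derivative_eq_intros)
  then have "((\<lambda>t. F (x + t *\<^sub>R h)) has_derivative (\<lambda>t. D (t *\<^sub>R h))) (at_right 0)"
    by (rule has_derivative_compose) (simp add: assms)
  then have "((\<lambda>t. norm (F (x + t *\<^sub>R h) - F x - D (t *\<^sub>R h)) / norm t) \<longlongrightarrow> 0) (at_right 0)"
    unfolding has_derivative_iff_norm by simp
  moreover have "norm (F (x + t *\<^sub>R h) - F x - D (t *\<^sub>R h)) / norm t
      = norm ((F (x + t *\<^sub>R h) - F x) /\<^sub>R t - D h)" if "t > 0" for t
  proof -
    have "F (x + t *\<^sub>R h) - F x - D (t *\<^sub>R h) = t *\<^sub>R ((F (x + t *\<^sub>R h) - F x) /\<^sub>R t - D h)"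
      using that by (simp add: linear_scale[OF lin] scaleR_diff_right)
    then show ?thesis
      using that by simp
  qed
  then have "\<forall>\<^sub>F t in at_right 0. norm (F (x + t *\<^sub>R h) - F x - D (t *\<^sub>R h)) / norm t
      = norm ((F (x + t *\<^sub>R h) - F x) /\<^sub>R t - D h)"
    by (rule eventually_mono[OF eventually_at_right_less])
  ultimately have "((\<lambda>t. norm ((F (x + t *\<^sub>R h) - F x) /\<^sub>R t - D h)) \<longlongrightarrow> 0) (at_right 0)"
    by (rule Lim_transform_eventually)
  then show ?thesis
    by (rule LIM_zero_cancel[OF tendsto_norm_zero_cancel])
qed

text \<open>The mixed second difference of a potential is evaluated in both orders.\<close>

lemma gradient_derivative_symmetric:
  fixes G :: "'a::real_inner \<Rightarrow> 'a"
  assumes g: "\<And>y. GDERIV g y :> G y" and D: "(G has_derivative D) (at x)"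
  shows "D h \<bullet> k = h \<bullet> D k"
proof -
  define \<Delta> where "\<Delta> h k t = g (x + t *\<^sub>R h + t *\<^sub>R k) - g (x + t *\<^sub>R h) - (g (x + t *\<^sub>R k) - g x)"
    for h k t
  have lin: "linear D"
    using D has_derivative_linear by blast
  \<comment> \<open>The pairing of \<open>D h\<close> with \<open>k\<close> is the limit of
    \<open>\<Delta> h k t\<close> / t^2. The mean value theorem acts along \<open>k\<close>, after
    which differentiability of \<open>G\<close> at the single point \<open>x\<close> evaluates both
    gradients.\<close>
  have *: "\<exists>d>0. \<forall>t. 0 < t \<and> t < d \<longrightarrow> \<bar>\<Delta> h k t - t\<^sup>2 * (D h \<bullet> k)\<bar> \<le> e * t\<^sup>2" if "e > 0" for e h k
  proof -
    define N where "N = norm h + norm k"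
    \<comment> \<open>Two errors of size e' t N, paired with a vector of length at most t N, add up
      to 2 e' N^2 t^2; the added 1 keeps the denominator positive when \<open>N\<close> is
      zero.\<close>
    define e' where "e' = e / (2 * N\<^sup>2 + 1)"
    have N: "N \<ge> 0" "norm h \<le> N" "norm k \<le> N" by (auto simp: N_def)
    have "0 < 2 * N\<^sup>2 + 1" by (simp add: add_nonneg_pos)
    then have e': "e' > 0" "e' * (2 * N\<^sup>2) \<le> e"
      using that by (auto simp: e'_def field_simps)
    obtain d' where d': "d' > 0"
      "\<And>y. norm (y - x) < d' \<Longrightarrow> norm (G y - G x - D (y - x)) \<le> e' * norm (y - x)"
      using D e'(1) unfolding has_derivative_at_alt by blast
    show ?thesis
    proof (intro exI conjI allI impI)
      show "d' / (N + 1) > 0" using d' N by simp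
      fix t assume "0 < t \<and> t < d' / (N + 1)"
      then have t: "0 < t" "t * N + t < d'"
        using N by (auto simp: field_simps)
      define \<phi> where "\<phi> s = g (x + t *\<^sub>R h + s *\<^sub>R t *\<^sub>R k) - g (x + s *\<^sub>R t *\<^sub>R k)" for s
      define \<phi>' where "\<phi>' s = G (x + t *\<^sub>R h + s *\<^sub>R t *\<^sub>R k) \<bullet> (t *\<^sub>R k) - G (x + s *\<^sub>R t *\<^sub>R k) \<bullet> (t *\<^sub>R k)" for s
      have "(\<phi> has_real_derivative \<phi>' s) (at s)" for s
        unfolding \<phi>_def \<phi>'_def by (intro DERIV_diff GDERIV_line g)
      then have "\<exists>s>0. s < 1 \<and> \<phi> 1 - \<phi> 0 = (1 - 0) * \<phi>' s"
        by (intro MVT2) auto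
      then obtain s where s: "0 < s" "s < 1" "\<phi> 1 - \<phi> 0 = \<phi>' s" by auto
      have close: "norm (G (x + w) - G x - D w) \<le> e' * (t * N)" if "norm w \<le> t * N" for w
      proof -
        have "norm w < d'" using that t by simp
        then have "norm (G (x + w) - G x - D w) \<le> e' * norm w"
          using d'(2)[of "x + w"] by simp
        also have "\<dots> \<le> e' * (t * N)" using that e' by (intro mult_left_mono) auto
        finally show ?thesis .
      qed
      define w1 where "w1 = t *\<^sub>R h + s *\<^sub>R t *\<^sub>R k"
      define w2 where "w2 = s *\<^sub>R t *\<^sub>R k"
      have sk: "norm w2 \<le> t * norm k"
        using s t by (simp add: w2_def mult_left_le_one_le)
      moreover have "norm w1 \<le> norm (t *\<^sub>R h) + norm w2"
        unfolding w1_def w2_def by (rule norm_triangle_ineq)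
      ultimately have "norm w1 \<le> t * N"
        using t by (simp add: N_def distrib_left)
      moreover have "norm w2 \<le> t * N"
        using sk N(3) t by (meson mult_left_mono less_imp_le order_trans)
      ultimately have "norm ((G (x + w1) - G x - D w1) - (G (x + w2) - G x - D w2)) \<le> e' * (t * N) + e' * (t * N)"
        by (intro norm_triangle_le_diff add_mono close)
      moreover have "(G (x + w1) - G x - D w1) - (G (x + w2) - G x - D w2) = G (x + w1) - G (x + w2) - t *\<^sub>R D h"
        by (simp add: w1_def w2_def linear_add[OF lin] linear_scale[OF lin])
      ultimately have near: "norm (G (x + w1) - G (x + w2) - t *\<^sub>R D h) \<le> e' * (t * N) + e' * (t * N)" by simp
      have "\<Delta> h k t - t\<^sup>2 * (D h \<bullet> k) = \<phi>' s - t\<^sup>2 * (D h \<bullet> k)"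
        using s(3) by (simp add: \<phi>_def \<Delta>_def)
      also have "\<dots> = (G (x + w1) - G (x + w2) - t *\<^sub>R D h) \<bullet> (t *\<^sub>R k)"
        by (simp add: \<phi>'_def w1_def w2_def inner_diff_left add.assoc power2_eq_square right_diff_distrib)
      finally have eq: "\<Delta> h k t - t\<^sup>2 * (D h \<bullet> k) = (G (x + w1) - G (x + w2) - t *\<^sub>R D h) \<bullet> (t *\<^sub>R k)" .
      have "\<bar>\<Delta> h k t - t\<^sup>2 * (D h \<bullet> k)\<bar> \<le> norm (G (x + w1) - G (x + w2) - t *\<^sub>R D h) * norm (t *\<^sub>R k)"
        unfolding eq by (rule Cauchy_Schwarz_ineq2)
      also have "\<dots> \<le> (e' * (t * N) + e' * (t * N)) * (t * N)"
        using near t N e' by (intro mult_mono) auto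
      also have "\<dots> = e' * (2 * N\<^sup>2) * t\<^sup>2"
        by (simp add: power2_eq_square algebra_simps)
      also have "\<dots> \<le> e * t\<^sup>2"
        using e' by (intro mult_right_mono) auto
      finally show "\<bar>\<Delta> h k t - t\<^sup>2 * (D h \<bullet> k)\<bar> \<le> e * t\<^sup>2" .
    qed
  qed
  have "\<bar>D h \<bullet> k - D k \<bullet> h\<bar> \<le> e" if e: "e > 0" for e
  proof -
    obtain d1 where d1: "d1 > 0" "\<And>t. 0 < t \<Longrightarrow> t < d1 \<Longrightarrow> \<bar>\<Delta> h k t - t\<^sup>2 * (D h \<bullet> k)\<bar> \<le> e / 2 * t\<^sup>2"
      using *[OF half_gt_zero[OF e], of h k] by blast
    obtain d2 where d2: "d2 > 0" "\<And>t. 0 < t \<Longrightarrow> t < d2 \<Longrightarrow> \<bar>\<Delta> k h t - t\<^sup>2 * (D k \<bullet> h)\<bar> \<le> e / 2 * t\<^sup>2"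
      using *[OF half_gt_zero[OF e], of k h] by blast
    obtain t where t: "0 < t" "t < d1" "t < d2"
      using d1 d2 by (meson field_lbound_gt_zero)
    have "\<Delta> h k t = \<Delta> k h t"
      by (simp add: \<Delta>_def algebra_simps)
    then have "\<bar>t\<^sup>2 * (D h \<bullet> k) - t\<^sup>2 * (D k \<bullet> h)\<bar> \<le> e / 2 * t\<^sup>2 + e / 2 * t\<^sup>2"
      using d1(2)[OF t(1,2)] d2(2)[OF t(1,3)] by linarith
    then have "\<bar>t\<^sup>2 * (D h \<bullet> k - D k \<bullet> h)\<bar> \<le> t\<^sup>2 * e"
      unfolding right_diff_distrib by (simp add: mult.commute)
    then have "t\<^sup>2 * \<bar>D h \<bullet> k - D k \<bullet> h\<bar> \<le> t\<^sup>2 * e"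
      by (simp add: abs_mult)
    then show ?thesis using t by simp
  qed
  then have "\<bar>D h \<bullet> k - D k \<bullet> h\<bar> \<le> 0"
    by (rule field_le_epsilon) simp
  then show ?thesis by (simp add: inner_commute)
qed

lemma norm_derivative_le_Lipschitz:
  assumes "\<And>x y. norm (F x - F y) \<le> L * norm (x - y)" and "(F has_derivative D) (at x)"
  shows "norm (D h) \<le> L * norm h"
proof (rule tendsto_upperbound[OF tendsto_norm[OF has_derivative_directional[OF assms(2)]]])
  show "\<forall>\<^sub>F t in at_right 0. norm ((F (x + t *\<^sub>R h) - F x) /\<^sub>R t) \<le> L * norm h"
    using eventually_at_right_less
  proof eventually_elim
    case (elim t)
    then have "norm ((F (x + t *\<^sub>R h) - F x) /\<^sub>R t) = norm (F (x + t *\<^sub>R h) - F x) / t"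
      by (simp add: divide_inverse mult.commute)
    also have "\<dots> \<le> L * (t * norm h) / t"
      using assms(1)[of "x + t *\<^sub>R h" x] elim by (intro divide_right_mono) auto
    finally show ?case using elim by simp
  qed
qed simp

lemma norm_closest_point_diff_le:
  fixes S :: "'a::euclidean_space set"
  assumes "convex S" "closed S" "S \<noteq> {}"
  shows "norm (closest_point S x - closest_point S y) \<le> norm (x - y)"
  using closest_point_lipschitz[OF assms] by (simp add: dist_norm)

text \<open>The projection of \<open>x\<close> is a competitor at \<open>y\<close>, which gives the
  upper quadratic bound; exchanging the points and using monotonicity of the residual
  \<open>r\<close> gives the lower one. Differentiability of the projection does not enter.\<close>

lemma GDERIV_half_sqdist_closest_point:
  fixes S :: "'a::euclidean_space set"
  assumes S: "convex S" "closed S" "S \<noteq> {}"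
  shows "GDERIV (\<lambda>x. 1/2 * (norm (x - closest_point S x))\<^sup>2) x :> x - closest_point S x"
proof -
  define g where "g x = 1/2 * (norm (x - closest_point S x))\<^sup>2" for x
  define r where "r x = x - closest_point S x" for x
  have up: "g y \<le> g x + (y - x) \<bullet> r x + 1/2 * (norm (y - x))\<^sup>2" for x y
  proof -
    have "norm (r y) \<le> norm (y - closest_point S x)"
      using closest_point_le[OF S(2) closest_point_in_set[OF S(2,3)], of y x] by (simp add: r_def dist_norm)
    also have "y - closest_point S x = r x + (y - x)"
      by (simp add: r_def)
    finally have "(norm (r y))\<^sup>2 \<le> (norm (r x + (y - x)))\<^sup>2"
      by (intro power_mono) auto
    also have "\<dots> = (norm (r x))\<^sup>2 + 2 * ((y - x) \<bullet> r x) + (norm (y - x))\<^sup>2"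
      unfolding power2_norm_eq_inner by (simp add: inner_add_left inner_add_right inner_commute)
    finally show ?thesis by (simp add: g_def r_def)
  qed
  have mono: "0 \<le> (y - x) \<bullet> (r y - r x)" for x y
  proof -
    have "(y - x) \<bullet> (closest_point S y - closest_point S x) \<le> norm (y - x) * norm (y - x)"
      using norm_cauchy_schwarz norm_closest_point_diff_le[OF S] by (meson mult_left_mono norm_ge_zero order_trans)
    then show ?thesis
      by (simp add: r_def inner_diff_right power2_norm_eq_inner flip: power2_eq_square)
  qed
  have quad: "\<bar>g y - g x - (y - x) \<bullet> r x\<bar> \<le> 1/2 * (norm (y - x))\<^sup>2" for y
  proof -
    have "(x - y) \<bullet> r y = - ((y - x) \<bullet> r y)"
      by (metis inner_minus_left minus_diff_eq)
    then show ?thesis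
      using up[of y x] up[of x y] mono[of y x] norm_minus_commute[of x y]
      unfolding abs_le_iff inner_diff_right by simp
  qed
  have "\<exists>d>0. \<forall>y. norm (y - x) < d \<longrightarrow> norm (g y - g x - (y - x) \<bullet> r x) \<le> e * norm (y - x)"
    if "e > 0" for e
  proof (intro exI[of _ e] conjI allI impI that)
    fix y assume "norm (y - x) < e"
    then have "norm (y - x) * norm (y - x) \<le> e * norm (y - x)"
      by (intro mult_right_mono) auto
    then show "norm (g y - g x - (y - x) \<bullet> r x) \<le> e * norm (y - x)"
      using quad[of y] zero_le_power2[of "norm (y - x)"] unfolding power2_eq_square real_norm_def by linarith
  qed
  then have "(g has_derivative (\<lambda>h. h \<bullet> r x)) (at x)"
    unfolding has_derivative_at_alt by (simp add: bounded_linear_inner_left)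
  then show ?thesis
    unfolding gderiv_def g_def r_def .
qed

text \<open>Symmetry and norm at most 1 are preserved by limits and convex combinations, so it
  suffices to check derivatives. These are symmetric because the identity minus the projection is a
  gradient, and bounded because projections are nonexpansive.\<close>

lemma clarke_jacobian_closest_point:
  fixes S :: "'a::euclidean_space set"
  assumes S: "convex S" "closed S" "S \<noteq> {}" and V: "V \<in> clarke_jacobian (closest_point S) x"
  shows "blinfun_apply V h \<bullet> k = h \<bullet> blinfun_apply V k" and "norm (blinfun_apply V h) \<le> norm h"
proof -
  define Q :: "('a \<Rightarrow>\<^sub>L 'a) set" where "Q = {V. \<forall>h k. blinfun_apply V h \<bullet> k = h \<bullet> blinfun_apply V k} \<inter> cball 0 1"
  have "convex {V :: 'a \<Rightarrow>\<^sub>L 'a. \<forall>h k. blinfun_apply V h \<bullet> k = h \<bullet> blinfun_apply V k}"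
    unfolding convex_def by (simp add: blinfun.add_left blinfun.scaleR_left inner_add_left inner_add_right)
  then have "convex Q"
    unfolding Q_def by (intro convex_Int convex_cball)
  moreover have "B_subdiff (closest_point S) x \<subseteq> Q"
  proof
    fix V assume "V \<in> B_subdiff (closest_point S) x"
    then obtain s D where D: "\<And>k::nat. (closest_point S has_derivative blinfun_apply (D k)) (at (s k))" "D \<longlonglongrightarrow> V"
      unfolding B_subdiff_def by blast
    have D_sym: "D n h \<bullet> k = h \<bullet> D n k" for n h k
    proof -
      have "((\<lambda>x. x - closest_point S x) has_derivative (\<lambda>h. h - D n h)) (at (s n))"
        by (intro derivative_intros D)
      from gradient_derivative_symmetric[OF GDERIV_half_sqdist_closest_point[OF S] this, of h k]
      show ?thesis by (simp add: inner_diff_left inner_diff_right)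
    qed
    have sym: "V h \<bullet> k = h \<bullet> V k" for h k
    proof (rule LIMSEQ_unique)
      show "(\<lambda>n. D n h \<bullet> k) \<longlonglongrightarrow> V h \<bullet> k"
        by (intro tendsto_inner blinfun.tendsto D(2) tendsto_const)
      show "(\<lambda>n. D n h \<bullet> k) \<longlonglongrightarrow> h \<bullet> V k"
        unfolding D_sym by (intro tendsto_inner blinfun.tendsto D(2) tendsto_const)
    qed
    have "norm (D n) \<le> 1" for n
      by (rule norm_blinfun_bound)
        (use norm_derivative_le_Lipschitz[of "closest_point S" 1, OF _ D(1)] norm_closest_point_diff_le[OF S] in auto)
    then have "norm V \<le> 1"
      by (intro tendsto_upperbound[OF tendsto_norm[OF D(2)]] always_eventually) auto
    with sym show "V \<in> Q" by (simp add: Q_def)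
  qed
  ultimately have "V \<in> Q"
    using V unfolding clarke_jacobian_def by (meson hull_minimal subsetD)
  then have sym: "\<forall>h k. V h \<bullet> k = h \<bullet> V k" and "norm V \<le> 1"
    unfolding Q_def by auto
  from sym show "V h \<bullet> k = h \<bullet> V k" by blast
  have "norm (V h) \<le> norm V * norm h"
    by (rule norm_blinfun)
  also have "\<dots> \<le> 1 * norm h"
    using \<open>norm V \<le> 1\<close> by (intro mult_right_mono) auto
  finally show "norm (V h) \<le> norm h" by simp
qed

text \<open>Directional limits exist one direction at a time; compactness of the unit sphere reduces
  them to a finite net, and the Lipschitz bound carries the estimate to all directions
  uniformly.\<close>

lemma directionally_differentiable_radial:
  fixes F :: "'a::euclidean_space \<Rightarrow> 'b::real_normed_vector"
  assumes Lip: "L-lipschitz_on (ball x r) F" and r: "r > 0"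
    and dd: "directionally_differentiable_at F x" and e: "e > 0"
  shows "\<forall>\<^sub>F h in nhds 0. \<forall>t\<in>{0..1}.
    norm (F (x + t *\<^sub>R h) - F x - t *\<^sub>R (F (x + h) - F x)) \<le> e * norm h"
proof -
  define q where "q t u = (F (x + t *\<^sub>R u) - F x) /\<^sub>R t" for t u
  have L: "L \<ge> 0" using Lip by (rule lipschitz_on_nonneg)
  \<comment> \<open>Moving the direction by less than \<open>\<rho>\<close> changes a difference
    quotient by at most e / 4; the added 1 admits \<open>L = 0\<close>.\<close>
  define \<rho> where "\<rho> = e / (4 * (L + 1))"
  have \<rho>: "\<rho> > 0" "L * \<rho> \<le> e / 4"
    using e L by (auto simp: \<rho>_def field_simps)
  obtain N where N: "finite N" "sphere (0::'a) 1 \<subseteq> (\<Union>u\<in>N. ball u \<rho>)"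
    using compact_sphere[of "0::'a" 1] \<rho>(1) unfolding compact_eq_totally_bounded by blast
  obtain l where l: "\<And>u. ((\<lambda>t. q t u) \<longlongrightarrow> l u) (at_right 0)"
    using dd unfolding directionally_differentiable_at_def q_def by metis
  \<comment> \<open>The net centres obtained above need not be unit vectors, so staying in the
    Lipschitz ball is requested for them separately.\<close>
  have "\<forall>\<^sub>F t in at_right 0. \<forall>u\<in>N. dist (q t u) (l u) < e / 4 \<and> t * norm u < r"
  proof (intro eventually_ball_finite N ballI eventually_conj)
    fix u
    show "\<forall>\<^sub>F t in at_right 0. dist (q t u) (l u) < e / 4"
      by (rule tendstoD[OF l]) (use e in simp)
    have "((\<lambda>t. t * norm u) \<longlongrightarrow> 0 * norm u) (at_right 0)"
      by (intro tendsto_intros)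
    then show "\<forall>\<^sub>F t in at_right 0. t * norm u < r"
      using r by (auto intro: order_tendstoD)
  qed
  then obtain d0 where d0: "d0 > 0"
    "\<And>t u. 0 < t \<Longrightarrow> t < d0 \<Longrightarrow> u \<in> N \<Longrightarrow> dist (q t u) (l u) < e / 4 \<and> t * norm u < r"
    unfolding eventually_at_right_field by blast
  define d where "d = min d0 r"
  have d: "d > 0" using d0 r by (simp add: d_def)
  have q_near: "dist (q t u) (l u0) \<le> e / 2"
    if t: "0 < t" "t < d" and u: "norm u = 1" and u0: "u0 \<in> N" "u \<in> ball u0 \<rho>" for t u u0
  proof -
    have tu0: "dist (q t u0) (l u0) < e / 4" "t * norm u0 < r"
      using d0(2)[of t u0] t u0 by (auto simp: d_def)
    have "dist (q t u) (q t u0) = norm (F (x + t *\<^sub>R u) - F (x + t *\<^sub>R u0)) / t"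
      using t by (simp add: q_def dist_norm divide_inverse mult.commute flip: scaleR_diff_right)
    also have "norm (F (x + t *\<^sub>R u) - F (x + t *\<^sub>R u0)) \<le> L * dist (x + t *\<^sub>R u) (x + t *\<^sub>R u0)"
      using lipschitz_onD[OF Lip, of "x + t *\<^sub>R u" "x + t *\<^sub>R u0"] t u tu0
      by (simp add: dist_norm d_def)
    also have "dist (x + t *\<^sub>R u) (x + t *\<^sub>R u0) = t * dist u u0"
      using t by (simp add: dist_norm flip: scaleR_diff_right)
    also have "L * (t * dist u u0) \<le> L * (t * \<rho>)"
      using u0 t L by (intro mult_left_mono) (auto simp: dist_commute)
    also have "L * (t * \<rho>) / t = L * \<rho>"
      using t by simp
    finally have "dist (q t u) (q t u0) \<le> e / 4"
      using \<rho> t by (simp add: divide_right_mono)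
    then show ?thesis
      using tu0 dist_triangle[of "q t u" "l u0" "q t u0"] by simp
  qed
  have "norm (F (x + t *\<^sub>R h) - F x - t *\<^sub>R (F (x + h) - F x)) \<le> e * norm h"
    if h: "norm h < d" and t: "t \<in> {0..1}" for h t
  proof (cases "h = 0 \<or> t = 0")
    case True
    then show ?thesis using e by auto
  next
    case False
    define s where "s = norm h"
    define u where "u = h /\<^sub>R s"
    have s: "0 < s" "s < d" and u: "norm u = 1" and hu: "h = s *\<^sub>R u"
      using False h by (auto simp: s_def u_def)
    have t01: "0 < t" "t \<le> 1" using t False by auto
    have ts: "0 < t * s" "t * s < d"
      using t01 s by (auto intro: le_less_trans[OF mult_left_le_one_le])
    obtain u0 where u0: "u0 \<in> N" "u \<in> ball u0 \<rho>"
      using N(2) u by (force simp: subset_iff)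
    \<comment> \<open>The quotients at lengths \<open>t * s\<close> and \<open>s\<close> are both
      within e / 2 of the same limit \<open>l u0\<close>.\<close>
    have "dist (q (t * s) u) (q s u) \<le> e"
      using q_near[OF ts u u0] q_near[OF s u u0] dist_triangle2[of "q (t * s) u" "q s u" "l u0"] by simp
    have "F (x + c *\<^sub>R u) - F x = c *\<^sub>R q c u" if "c > 0" for c
      using that by (simp add: q_def)
    from this[OF ts(1)] this[OF s(1)]
    have "F (x + t *\<^sub>R h) - F x - t *\<^sub>R (F (x + h) - F x) = (t * s) *\<^sub>R (q (t * s) u - q s u)"
      by (simp add: hu scaleR_diff_right)
    with \<open>dist (q (t * s) u) (q s u) \<le> e\<close> have "norm (F (x + t *\<^sub>R h) - F x - t *\<^sub>R (F (x + h) - F x)) \<le> (t * s) * e"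
      using ts by (simp add: dist_norm mult_left_mono)
    also have "\<dots> \<le> s * e"
      using t01 s e by (intro mult_right_mono mult_left_le_one_le) auto
    finally show ?thesis by (simp add: s_def mult.commute)
  qed
  then show ?thesis
    using d unfolding eventually_nhds_metric by (auto simp: dist_norm)
qed

section \<open>Proximal maps and Moreau envelopes of indicator functions\<close>

text \<open>Outside \<open>S\<close> the objective is infinite, and on \<open>S\<close> it increases
  strictly with the distance to \<open>x\<close>, so minimizing it is projecting; uniqueness of the
  projection resolves the definite description.\<close>

lemma Prox_indicator_ext:
  fixes S :: "'a::euclidean_space set"
  assumes S: "convex S" "closed S" "S \<noteq> {}"
  shows "Prox (indicator_ext S) x = closest_point S x"
proof -
  let ?\<phi> = "\<lambda>y. indicator_ext S y + ereal (1/2 * (norm (y - x))\<^sup>2)"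
  have p: "closest_point S x \<in> S" using S by (simp add: closest_point_in_set)
  have le: "norm (closest_point S x - x) \<le> norm (y - x)" if "y \<in> S" for y
    using closest_point_le[OF S(2) that, of x] by (simp add: dist_norm norm_minus_commute)
  have "is_arg_min ?\<phi> (\<lambda>_. True) y \<longleftrightarrow> y = closest_point S x" for y
  proof
    assume "is_arg_min ?\<phi> (\<lambda>_. True) y"
    then have min: "?\<phi> y \<le> ?\<phi> z" for z
      unfolding is_arg_min_def by (meson leI)
    have "y \<in> S"
      using min[of "closest_point S x"] p by (auto simp: indicator_ext_def split: if_splits)
    moreover have "dist x y \<le> dist x z" if "z \<in> S" for z
    proof -
      have "(norm (y - x))\<^sup>2 \<le> (norm (z - x))\<^sup>2"
        using min[of z] that \<open>y \<in> S\<close> by (simp add: indicator_ext_def)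
      then show ?thesis
        by (metis dist_norm norm_minus_commute norm_ge_zero power2_le_imp_le)
    qed
    ultimately show "y = closest_point S x"
      using closest_point_unique S by blast
  next
    assume "y = closest_point S x"
    moreover have "?\<phi> (closest_point S x) \<le> ?\<phi> z" for z
      using p le[of z] by (auto simp: indicator_ext_def intro: power_mono)
    ultimately show "is_arg_min ?\<phi> (\<lambda>_. True) y"
      unfolding is_arg_min_def by (simp add: not_less)
  qed
  then show ?thesis
    unfolding Prox_def by (intro the_equality) blast+
qed

lemma moreau_env_indicator_ext:
  fixes S :: "'a::euclidean_space set"
  assumes S: "convex S" "closed S" "S \<noteq> {}"
  shows "moreau_env (indicator_ext S) x = 1/2 * (norm (x - closest_point S x))\<^sup>2"
proof -
  let ?\<phi> = "\<lambda>y. indicator_ext S y + ereal (1/2 * (norm (y - x))\<^sup>2)"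
  have p: "closest_point S x \<in> S" using S by (simp add: closest_point_in_set)
  have "(INF y. ?\<phi> y) = ?\<phi> (closest_point S x)"
  proof (rule antisym)
    show "?\<phi> (closest_point S x) \<le> (INF y. ?\<phi> y)"
    proof (rule INF_greatest)
      fix y
      have "norm (closest_point S x - x) \<le> norm (y - x)" if "y \<in> S"
        using closest_point_le[OF S(2) that, of x] by (simp add: dist_norm norm_minus_commute)
      then show "?\<phi> (closest_point S x) \<le> ?\<phi> y"
        using p by (auto simp: indicator_ext_def intro: power_mono)
    qed
  qed (rule INF_lower, simp)
  then show ?thesis
    using p by (simp add: moreau_env_def indicator_ext_def norm_minus_commute)
qed


section \<open>The problem data\<close>

lemma convex_nonpos_mats: "convex nonpos_mats"
  unfolding convex_def nonpos_mats_def
  by (auto intro!: add_nonpos_nonpos mult_nonneg_nonpos)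

lemma closed_nonpos_mats: "closed (nonpos_mats :: (real^'n^'n) set)"
proof -
  have eq: "nonpos_mats = (\<Inter>i. \<Inter>j. {M :: real^'n^'n. M $ i $ j \<le> 0})"
    by (auto simp: nonpos_mats_def)
  show ?thesis
    unfolding eq by (intro closed_INT ballI closed_Collect_le continuous_intros)
qed

lemma nonpos_mats_nonempty: "nonpos_mats \<noteq> {}"
  using mem_Collect_eq[of "0 :: real^'n^'n"] by (auto simp: nonpos_mats_def intro!: exI[of _ 0])

lemmas nonpos_mats_props = convex_nonpos_mats closed_nonpos_mats nonpos_mats_nonempty

text \<open>The Frobenius norm separates over entries, so truncating each entry minimizes every
  coordinate distance at once.\<close>

lemma Pi_minus_nth:
  fixes M :: "real^'n^'n"
  shows "Pi_minus M $ i $ j = min 0 (M $ i $ j)"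
proof -
  define P :: "real^'n^'n" where "P = (\<chi> i j. min 0 (M $ i $ j))"
  have "norm (M - P) \<le> norm (M - Z)" if "Z \<in> nonpos_mats" for Z
  proof (intro norm_le_componentwise_cart)
    fix i j
    have "Z $ i $ j \<le> 0" using that by (simp add: nonpos_mats_def)
    then show "norm ((M - P) $ i $ j) \<le> norm ((M - Z) $ i $ j)"
      by (simp add: P_def min_def)
  qed
  then have "P = Pi_minus M"
    unfolding Pi_minus_def
    by (intro closest_point_unique nonpos_mats_props) (auto simp: nonpos_mats_def P_def dist_norm)
  then show ?thesis by (metis P_def vec_lambda_beta)
qed

text \<open>The difference quotient of an entry involves that entry alone. The third case is free of
  any sign condition on \<open>s\<close>, so it also covers entries at the kink.\<close>

lemma Pi_minus_derivative_nth:
  assumes D: "(Pi_minus has_derivative D) (at s)"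
  shows "s $ i $ j > 0 \<Longrightarrow> D h $ i $ j = 0"
    and "s $ i $ j < 0 \<Longrightarrow> D h $ i $ j = h $ i $ j"
    and "h $ i $ j = 0 \<Longrightarrow> D h $ i $ j = 0"
proof -
  have lim: "((\<lambda>t. (min 0 (s $ i $ j + t * h $ i $ j) - min 0 (s $ i $ j)) / t) \<longlongrightarrow> D h $ i $ j) (at_right 0)"
    using tendsto_vec_nth[OF tendsto_vec_nth[OF has_derivative_directional[OF D, of h]], of i j]
    by (simp add: Pi_minus_nth divide_inverse mult.commute)
  have D_eq: "D h $ i $ j = c"
    if "\<forall>\<^sub>F t in at_right 0. (min 0 (s $ i $ j + t * h $ i $ j) - min 0 (s $ i $ j)) / t = c" for c
    using tendsto_unique[OF _ lim tendsto_eventually[OF that]] by simp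
  have cont: "((\<lambda>t. s $ i $ j + t * h $ i $ j) \<longlongrightarrow> s $ i $ j) (at_right 0)"
    by (auto intro!: tendsto_eq_intros)
  show "D h $ i $ j = 0" if "s $ i $ j > 0"
    using order_tendstoD(1)[OF cont that] by (intro D_eq) (auto elim!: eventually_mono simp: that)
  show "D h $ i $ j = h $ i $ j" if "s $ i $ j < 0"
  proof (rule D_eq)
    show "\<forall>\<^sub>F t in at_right 0. (min 0 (s $ i $ j + t * h $ i $ j) - min 0 (s $ i $ j)) / t = h $ i $ j"
      using order_tendstoD(2)[OF cont that] eventually_at_right_less
    proof eventually_elim
      case (elim t)
      then have "min 0 (s $ i $ j + t * h $ i $ j) = s $ i $ j + t * h $ i $ j" "min 0 (s $ i $ j) = s $ i $ j"
        using that by auto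
      with elim show ?case by simp
    qed
  qed
  show "D h $ i $ j = 0" if "h $ i $ j = 0"
    by (intro D_eq) (simp add: that)
qed

text \<open>The conclusions are affine conditions on \<open>V\<close> and hence survive limits and
  convex hulls; strict signs of \<open>y\<close> persist along the approximating points
  \<open>s k\<close>.\<close>

lemma clarke_jacobian_Pi_minus_nth:
  fixes y h :: "real^'n^'n"
  assumes V: "V \<in> clarke_jacobian Pi_minus y"
  shows "y $ i $ j > 0 \<Longrightarrow> blinfun_apply V h $ i $ j = 0"
    and "y $ i $ j < 0 \<Longrightarrow> blinfun_apply V h $ i $ j = h $ i $ j"
    and "h $ i $ j = 0 \<Longrightarrow> blinfun_apply V h $ i $ j = 0"
proof -
  define Q where "Q = {V :: (real^'n^'n) \<Rightarrow>\<^sub>L (real^'n^'n).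
    (y $ i $ j > 0 \<longrightarrow> blinfun_apply V h $ i $ j = 0) \<and>
    (y $ i $ j < 0 \<longrightarrow> blinfun_apply V h $ i $ j = h $ i $ j) \<and>
    (h $ i $ j = 0 \<longrightarrow> blinfun_apply V h $ i $ j = 0)}"
  have "convex Q"
    unfolding convex_def Q_def
    by (auto simp: blinfun.add_left blinfun.scaleR_left simp flip: distrib_right)
  moreover have "B_subdiff Pi_minus y \<subseteq> Q"
  proof
    fix V :: "(real^'n^'n) \<Rightarrow>\<^sub>L (real^'n^'n)" assume "V \<in> B_subdiff Pi_minus y"
    then obtain s D where s: "s \<longlonglongrightarrow> y" and D: "\<And>k::nat. (Pi_minus has_derivative blinfun_apply (D k)) (at (s k))"
      and DV: "D \<longlonglongrightarrow> V"
      unfolding B_subdiff_def by blast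
    have lim: "(\<lambda>k. blinfun_apply (D k) h $ i $ j) \<longlonglongrightarrow> blinfun_apply V h $ i $ j"
      by (intro tendsto_vec_nth blinfun.tendsto DV tendsto_const)
    have s_lim: "(\<lambda>k. s k $ i $ j) \<longlonglongrightarrow> y $ i $ j"
      by (intro tendsto_vec_nth s)
    have V_eq: "blinfun_apply V h $ i $ j = c" if "\<forall>\<^sub>F k in sequentially. blinfun_apply (D k) h $ i $ j = c" for c
      using tendsto_unique[OF _ lim tendsto_eventually[OF that]] by simp
    have "blinfun_apply V h $ i $ j = 0" if "y $ i $ j > 0"
      by (rule V_eq[OF eventually_mono[OF order_tendstoD(1)[OF s_lim that]]])
        (rule Pi_minus_derivative_nth(1)[OF D])
    moreover have "blinfun_apply V h $ i $ j = h $ i $ j" if "y $ i $ j < 0"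
      by (rule V_eq[OF eventually_mono[OF order_tendstoD(2)[OF s_lim that]]])
        (rule Pi_minus_derivative_nth(2)[OF D])
    moreover have "blinfun_apply V h $ i $ j = 0" if "h $ i $ j = 0"
      by (rule V_eq) (simp add: Pi_minus_derivative_nth(3)[OF D that])
    ultimately show "V \<in> Q" by (simp add: Q_def)
  qed
  ultimately have "V \<in> Q"
    using V unfolding clarke_jacobian_def by (meson hull_minimal subsetD)
  then show "y $ i $ j > 0 \<Longrightarrow> blinfun_apply V h $ i $ j = 0"
    "y $ i $ j < 0 \<Longrightarrow> blinfun_apply V h $ i $ j = h $ i $ j"
    "h $ i $ j = 0 \<Longrightarrow> blinfun_apply V h $ i $ j = 0"
    by (auto simp: Q_def)
qed

lemma eventually_signs_preserved:
  fixes x :: "real^'n^'n"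
  shows "\<forall>\<^sub>F h in nhds 0. \<forall>i j. (x $ i $ j > 0 \<longrightarrow> (x + h) $ i $ j > 0) \<and> (x $ i $ j < 0 \<longrightarrow> (x + h) $ i $ j < 0)"
proof (intro eventually_all_finite)
  fix i j
  have lim: "((\<lambda>h. (x + h) $ i $ j) \<longlongrightarrow> (x + 0) $ i $ j) (nhds 0)"
    by (intro tendsto_vec_nth tendsto_add tendsto_const filterlim_ident)
  show "\<forall>\<^sub>F h in nhds 0. (x $ i $ j > 0 \<longrightarrow> (x + h) $ i $ j > 0) \<and> (x $ i $ j < 0 \<longrightarrow> (x + h) $ i $ j < 0)"
    using order_tendstoD(1)[OF lim, of 0] order_tendstoD(2)[OF lim, of 0]
    by (cases "x $ i $ j" "0::real" rule: linorder_cases) (auto elim!: eventually_mono)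
qed

text \<open>The projection is piecewise linear with kinks only where an entry is zero, so the
  semismoothness remainder vanishes outright near each point.\<close>

lemma Pi_minus_semismooth_exact:
  "\<forall>\<^sub>F h in nhds 0. \<forall>V \<in> clarke_jacobian Pi_minus (x + h).
     Pi_minus (x + h) - Pi_minus x = blinfun_apply V h"
  using eventually_signs_preserved[of x]
proof eventually_elim
  case (elim h)
  have "(Pi_minus (x + h) - Pi_minus x) $ i $ j = blinfun_apply V h $ i $ j"
    if V: "V \<in> clarke_jacobian Pi_minus (x + h)" for V i j
  proof -
    note V' = clarke_jacobian_Pi_minus_nth[OF V, where i = i and j = j and h = h]
    \<comment> \<open>A zero entry of \<open>x + h\<close> forces a zero entry of \<open>x\<close>,
      since nonzero signs are preserved, and therefore of \<open>h\<close>; there the third property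
      of \<open>V\<close> applies.\<close>
    consider "(x + h) $ i $ j > 0" | "(x + h) $ i $ j < 0" | "h $ i $ j = 0" "x $ i $ j = 0"
      using elim[rule_format, of i j] by (cases "x $ i $ j = 0"; cases "h $ i $ j = 0") force+
    then show ?thesis
    proof cases
      case 1
      then show ?thesis using V'(1) elim[rule_format, of i j] by (force simp: Pi_minus_nth min_def)
    next
      case 2
      then show ?thesis using V'(2) elim[rule_format, of i j] by (force simp: Pi_minus_nth min_def)
    next
      case 3
      then show ?thesis using V'(3) by (simp add: Pi_minus_nth)
    qed
  qed
  then show ?case by (simp add: vec_eq_iff)
qed

text \<open>For small \<open>h\<close> each entry stays on one side of zero along the whole segment,
  where truncation is a single linear branch.\<close>

lemma Pi_minus_radial_exact:
  "\<forall>\<^sub>F h in nhds 0. \<forall>t\<in>{0..1}.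
     Pi_minus (x + t *\<^sub>R h) - Pi_minus x = t *\<^sub>R (Pi_minus (x + h) - Pi_minus x)"
  using eventually_signs_preserved[of x]
proof eventually_elim
  case (elim h)
  have "min 0 (x $ i $ j + t * h $ i $ j) - min 0 (x $ i $ j) = t * (min 0 (x $ i $ j + h $ i $ j) - min 0 (x $ i $ j))"
    if t: "t \<in> {0..1}" for t i j
  proof -
    define a where "a = x $ i $ j"
    define b where "b = h $ i $ j"
    have ab: "a > 0 \<Longrightarrow> a + b > 0" "a < 0 \<Longrightarrow> a + b < 0"
      using elim[rule_format, of i j] by (auto simp: a_def b_def)
    \<comment> \<open>Written as a convex combination, the intermediate entry inherits the sign
      shared by the two end points.\<close>
    have conv: "a + t * b = (1 - t) * a + t * (a + b)"
      by (simp add: algebra_simps)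
    have "min 0 (a + t * b) - min 0 a = t * (min 0 (a + b) - min 0 a)"
    proof (cases a "0::real" rule: linorder_cases)
      case less
      then have "(1 - t) * a \<le> 0" "t * (a + b) \<le> 0"
        using ab t by (auto intro: mult_nonneg_nonpos)
      then have "a + t * b \<le> 0"
        unfolding conv by simp
      then have "min 0 (a + t * b) = a + t * b" "min 0 (a + b) = a + b" "min 0 a = a"
        using less ab by auto
      then show ?thesis by simp
    next
      case equal
      then show ?thesis using t by (auto simp: min_def mult_le_0_iff zero_le_mult_iff)
    next
      case greater
      then have "0 \<le> (1 - t) * a" "0 \<le> t * (a + b)"
        using ab t by auto
      then have "0 \<le> a + t * b"
        unfolding conv by simp
      then have "min 0 (a + t * b) = 0" "min 0 (a + b) = 0" "min 0 a = 0"
        using greater ab by auto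
      then show ?thesis by simp
    qed
    then show ?thesis by (simp add: a_def b_def)
  qed
  then show ?case by (simp add: vec_eq_iff Pi_minus_nth)
qed

section \<open>Admissible domains and their products\<close>

lemma linear_block: "linear (\<lambda>\<xi>. block \<xi> i)"
  by (rule linearI) (simp_all add: block_def vec_eq_iff)

text \<open>Treats the three norm balls together: subadditivity and scaling give convexity, and the
  factor 0 gives \<open>N 0 \<le> 0\<close>, hence a point in the set.\<close>

lemma sublevel_props:
  fixes N :: "'a::real_normed_vector \<Rightarrow> real"
  assumes sub: "\<And>x y. N (x + y) \<le> N x + N y" and scale: "\<And>c x. c \<ge> 0 \<Longrightarrow> N (c *\<^sub>R x) \<le> c * N x"
    and cont: "continuous_on UNIV N" and L: "L > 0"
  shows "convex {x. N x \<le> L} \<and> closed {x. N x \<le> L} \<and> {x. N x \<le> L} \<noteq> {}"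
proof (intro conjI)
  show "convex {x. N x \<le> L}"
  proof (rule convexI)
    fix x y and u v :: real
    assume *: "x \<in> {x. N x \<le> L}" "y \<in> {x. N x \<le> L}" "0 \<le> u" "0 \<le> v" "u + v = 1"
    have "N (u *\<^sub>R x + v *\<^sub>R y) \<le> u * N x + v * N y"
      using sub[of "u *\<^sub>R x" "v *\<^sub>R y"] scale[of u x] scale[of v y] * by linarith
    also have "\<dots> \<le> L"
      using * by (intro convex_bound_le) auto
    finally show "u *\<^sub>R x + v *\<^sub>R y \<in> {x. N x \<le> L}" by simp
  qed
  show "closed {x. N x \<le> L}"
    by (intro closed_Collect_le cont continuous_intros)
  have "N 0 \<le> L"
    using scale[of 0 0] L by simp
  then show "{x. N x \<le> L} \<noteq> {}" by blast
qed

lemma admissible_domain_props: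
  fixes D :: "(real^'d) set"
  assumes "admissible_domain D"
  shows "convex D" "closed D" "D \<noteq> {}"
proof -
  \<comment> \<open>With \<open>c\<close> equal to -1 or 1, both kinds of sign constraints become
    half-spaces of the same form.\<close>
  have half: "closed {x :: real^'d. c * x $ k \<le> b}" "convex {x :: real^'d. c * x $ k \<le> b}" for k c b
  proof -
    show "closed {x :: real^'d. c * x $ k \<le> b}"
      by (intro closed_Collect_le continuous_intros)
    have "convex ((\<lambda>x :: real^'d. c * x $ k) -` {..b})"
      by (intro convex_linear_vimage linearI) (auto simp: algebra_simps)
    then show "convex {x :: real^'d. c * x $ k \<le> b}"
      by (simp add: vimage_def)
  qed
  have "convex D \<and> closed D \<and> D \<noteq> {}"
    using assms unfolding admissible_domain_def
  proof (elim disjE exE conjE)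
    fix K1 K2 assume D: "D = {x. (\<forall>k\<in>K1. x $ k \<ge> 0) \<and> (\<forall>k\<in>K2. x $ k \<le> 0)}"
    have eq: "D = (\<Inter>k\<in>K1. {x. (-1) * x $ k \<le> 0}) \<inter> (\<Inter>k\<in>K2. {x. 1 * x $ k \<le> 0})"
      by (auto simp: D)
    have "convex D" "closed D"
      unfolding eq by (intro convex_Int convex_INT closed_Int closed_INT ballI half)+
    moreover have "0 \<in> D" by (simp add: D)
    ultimately show ?thesis by auto
  next
    fix L U assume "\<forall>k. L $ k \<le> U $ k" and D: "D = {x. \<forall>k. L $ k \<le> x $ k \<and> x $ k \<le> U $ k}"
    then have "L \<in> D" "D = cbox L U"
      by (auto simp: D mem_box_cart set_eq_iff)
    then show ?thesis by (auto simp: closed_cbox convex_box)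
  next
    fix L :: real assume L: "L > 0" and D: "D = {x. (\<Sum>k\<in>UNIV. \<bar>x $ k\<bar>) \<le> L}"
    show ?thesis
      unfolding D by (rule sublevel_props)
        (use L in \<open>auto simp: abs_mult sum_distrib_left simp flip: sum.distrib
          intro!: sum_mono continuous_intros\<close>)
  next
    fix L :: real assume L: "L > 0" and D: "D = {x. norm x \<le> L}"
    show ?thesis
      unfolding D by (rule sublevel_props)
        (use L in \<open>auto intro!: continuous_intros norm_triangle_ineq\<close>)
  next
    fix L :: real assume L: "L > 0" and D: "D = {x. infnorm x \<le> L}"
    show ?thesis
      unfolding D by (rule sublevel_props)
        (use L in \<open>auto simp: infnorm_mul intro!: continuous_intros infnorm_triangle\<close>)
  qed
  then show "convex D" "closed D" "D \<noteq> {}" by auto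
qed

text \<open>The n-fold product of \<open>D\<close>. Its indicator is \<open>p_fun D\<close>, which
  replaces a sum of indicators by a single projection.\<close>

definition block_domain :: "(real^'d) set \<Rightarrow> (real^('n::finite \<times> 'd::finite)) set" where
  "block_domain D = {\<xi>. \<forall>i. block \<xi> i \<in> D}"

lemma p_fun_eq_indicator:
  "(p_fun D :: real^('n::finite \<times> 'd::finite) \<Rightarrow> ereal) = indicator_ext (block_domain D)"
proof
  fix \<xi> :: "real^('n::finite \<times> 'd::finite)"
  show "p_fun D \<xi> = indicator_ext (block_domain D) \<xi>"
  proof (cases "\<xi> \<in> block_domain D")
    case True
    then show ?thesis by (simp add: p_fun_def indicator_ext_def block_domain_def)
  next
    case False
    then have "\<exists>i\<in>UNIV. indicator_ext D (block \<xi> i) = \<infinity>"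
      by (auto simp: block_domain_def indicator_ext_def)
    then have "p_fun D \<xi> = \<infinity>"
      unfolding p_fun_def sum_Pinfty by simp
    with False show ?thesis by (simp add: indicator_ext_def)
  qed
qed

lemma block_domain_props:
  assumes "convex D" "closed D" "D \<noteq> {}"
  shows "convex (block_domain D)" "closed (block_domain D)" "block_domain D \<noteq> {}"
proof -
  have eq: "block_domain D = (\<Inter>i. (\<lambda>\<xi>. block \<xi> i) -` D)"
    by (auto simp: block_domain_def)
  show "convex (block_domain D)"
    unfolding eq using linear_block assms(1) by (intro convex_INT convex_linear_vimage)
  show "closed (block_domain D)"
    unfolding eq using linear_block assms(2)
    by (intro closed_INT ballI closed_vimage linear_continuous_on linear_conv_bounded_linear[THEN iffD1]) auto
  obtain x where "x \<in> D" using assms(3) by blast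
  then have "block (\<chi> p. x $ snd p) i \<in> D" for i
    by (simp add: block_def)
  then show "block_domain D \<noteq> {}"
    unfolding block_domain_def by blast
qed

section \<open>Positive definite matrices and the linear operators\<close>

text \<open>The quadratic form attains a positive minimum on the compact unit sphere, and
  homogeneity of degree 2 extends the bound to all vectors.\<close>

lemma pos_def_mat_lower_bound:
  fixes H :: "real^'k^'k"
  assumes "pos_def_mat H"
  obtains m where "m > 0" "\<And>x. m * (norm x)\<^sup>2 \<le> (H *v x) \<bullet> x"
proof -
  have "continuous_on (sphere 0 1) (\<lambda>x. (H *v x) \<bullet> x)"
    by (intro continuous_intros linear_continuous_on) (simp flip: linear_conv_bounded_linear)
  moreover have "sphere (0 :: real^'k) 1 \<noteq> {}"
    by simp
  ultimately obtain w where "w \<in> sphere 0 1" "\<forall>x\<in>sphere 0 1. (H *v w) \<bullet> w \<le> (H *v x) \<bullet> x"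
    using continuous_attains_inf[OF compact_sphere] by blast
  then have w: "norm w = 1" "\<And>x. norm x = 1 \<Longrightarrow> (H *v w) \<bullet> w \<le> (H *v x) \<bullet> x"
    by auto
  show ?thesis
  proof
    show "(H *v w) \<bullet> w > 0"
      using assms w(1) unfolding pos_def_mat_def by (metis inner_commute norm_zero zero_neq_one)
    show "(H *v w) \<bullet> w * (norm x)\<^sup>2 \<le> (H *v x) \<bullet> x" for x
    proof (cases "x = 0")
      case False
      define u where "u = x /\<^sub>R norm x"
      have x: "x = norm x *\<^sub>R u" and "norm u = 1"
        using False by (auto simp: u_def)
      have "(H *v x) \<bullet> x = (norm x)\<^sup>2 * ((H *v u) \<bullet> u)"
        by (subst (1 2) x) (simp add: matrix_vector_mult_scaleR power2_eq_square)
      then show ?thesis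
        using w(2)[OF \<open>norm u = 1\<close>] by (simp add: mult.commute[of "(norm x)\<^sup>2"] mult_right_mono)
    qed simp
  qed
qed

lemma pos_def_mat_sym: "pos_def_mat H \<Longrightarrow> (H *v x) \<bullet> y = x \<bullet> (H *v y)"
  by (metis dot_lmul_matrix inner_commute pos_def_mat_def transpose_matrix_vector)

lemma norm_mat_power2:
  assumes "pos_def_mat H"
  shows "(norm_mat H x)\<^sup>2 = (H *v x) \<bullet> x"
proof -
  have "0 \<le> x \<bullet> (H *v x)"
    using assms unfolding pos_def_mat_def by (cases "x = 0") (auto intro: less_imp_le)
  then show ?thesis by (simp add: norm_mat_def inner_commute)
qed

lemma linear_A_op: "linear A_op"
  by (rule linearI) (simp_all add: A_op_def outer_def vec_eq_iff algebra_simps)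

lemma linear_B_op: "linear (B_op X)"
  by (rule linearI)
    (simp_all add: B_op_def vec_eq_iff linear_add[OF linear_block] linear_scale[OF linear_block]
      matrix_vector_right_distrib matrix_vector_mult_scaleR)

lemma norm_Pair_mono:
  assumes "norm a \<le> norm c" "norm b \<le> norm d"
  shows "norm (a, b) \<le> norm (c, d)"
  unfolding norm_Pair using assms by (intro real_sqrt_le_mono add_mono power_mono) auto

section \<open>Application to the function Phi\<close>

theorem theorem4:
  fixes X :: "real^'n^'d" and Y :: "real^'n" and D :: "(real^'d) set"
    and \<sigma> \<gamma> \<tau> \<delta> \<mu> :: real
    and \<theta>' :: "real^'n" and \<xi>' :: "real^('n::finite \<times> 'd::finite)"
    and u :: "real^'n^'n" and v :: "real^('n::finite \<times> 'd::finite)"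
    and H1 :: "real^'n^'n" and H2 :: "real^('n::finite \<times> 'd::finite)^('n::finite \<times> 'd::finite)"
    and \<theta> :: "nat \<Rightarrow> real^'n" and \<xi> :: "nat \<Rightarrow> real^('n::finite \<times> 'd::finite)"
  assumes "admissible_domain D"
    and "\<sigma> > 0"
    and "pos_def_mat H1" and "pos_def_mat H2"
    and "\<gamma> \<in> {0<..<1}" and "\<tau> \<in> {0<..1}" and "\<delta> \<in> {0<..<1}" and "\<mu> \<in> {0<..<1/2}"
    and "strongly_semismooth (Prox (p_fun D :: real^('n::finite \<times> 'd::finite) \<Rightarrow> ereal))
           (clarke_jacobian (Prox (p_fun D)))"
    and "ssn_sequence (Phi X Y D \<sigma> \<theta>' \<xi>' u v H1 H2) (gen_hess_Phi X D \<sigma> u v H1 H2)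
           \<gamma> \<tau> \<delta> \<mu> (\<lambda>j. (\<theta> j, \<xi> j))"
  shows "\<exists>\<theta>bar \<xi>bar.
      (\<forall>z. is_arg_min (Phi X Y D \<sigma> \<theta>' \<xi>' u v H1 H2) (\<lambda>_. True) z \<longleftrightarrow> z = (\<theta>bar, \<xi>bar))
    \<and> (\<lambda>j. (\<theta> j, \<xi> j)) \<longlonglongrightarrow> (\<theta>bar, \<xi>bar)
    \<and> (\<lambda>j. norm ((\<theta> (Suc j), \<xi> (Suc j)) - (\<theta>bar, \<xi>bar)))
        \<in> O(\<lambda>j. norm ((\<theta> j, \<xi> j) - (\<theta>bar, \<xi>bar)) powr (1 + \<tau>))"
proof -
  define P :: "(real^('n \<times> 'd)) set" where "P = block_domain D"
  have P: "convex P" "closed P" "P \<noteq> {}"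
    using block_domain_props admissible_domain_props[OF assms(1)] by (auto simp: P_def)
  have p_fun_P: "(p_fun D :: real^('n \<times> 'd) \<Rightarrow> ereal) = indicator_ext P"
    by (simp add: p_fun_eq_indicator P_def)
  have Prox_P: "Prox (p_fun D) = closest_point P"
    using Prox_indicator_ext[OF P] by (auto simp: p_fun_P)
  note ss = assms(9)[unfolded Prox_P strongly_semismooth_def]
  note \<sigma> = assms(2) and H1 = assms(3) and H2 = assms(4)
  let ?\<Phi> = "Phi X Y D \<sigma> \<theta>' \<xi>' u v H1 H2"
  let ?\<pi> = "\<lambda>M :: real^'n^'n. M - Pi_minus M" and ?\<rho> = "\<lambda>k. k - closest_point P k"

  \<comment> \<open>\<open>S\<close> and \<open>c\<close> come from the quadratic terms of
    \<open>Phi\<close>, while \<open>T z + a\<close> is the pair of points at which the two Moreau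
    envelopes are evaluated. \<open>U\<close> combines independently chosen elements of the two
    Clarke Jacobians, as in \<open>gen_hess_Phi\<close>.\<close>
  define S :: "(real^'n) \<times> (real^('n \<times> 'd)) \<Rightarrow> (real^'n) \<times> (real^('n \<times> 'd))"
    where "S z = (fst z + (H1 *v fst z) /\<^sub>R \<sigma>, (H2 *v snd z) /\<^sub>R \<sigma>)" for z
  define T :: "(real^'n) \<times> (real^('n \<times> 'd)) \<Rightarrow> (real^'n^'n) \<times> (real^('n \<times> 'd))"
    where "T z = (- A_op (fst z) - B_op X (snd z), snd z)" for z
  define p :: "(real^'n^'n) \<times> (real^('n \<times> 'd)) \<Rightarrow> (real^'n^'n) \<times> (real^('n \<times> 'd))"
    where "p y = (Pi_minus (fst y), closest_point P (snd y))" for y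
  define U :: "(real^'n^'n) \<times> (real^('n \<times> 'd)) \<Rightarrow> ((real^'n^'n) \<times> (real^('n \<times> 'd)) \<Rightarrow> (real^'n^'n) \<times> (real^('n \<times> 'd))) set"
    where "U y = {\<lambda>h. (blinfun_apply V (fst h), blinfun_apply W (snd h)) | V W.
      V \<in> clarke_jacobian Pi_minus (fst y) \<and> W \<in> clarke_jacobian (closest_point P) (snd y)}" for y
  define c where "c = (- Y - (H1 *v \<theta>') /\<^sub>R \<sigma>, - ((H2 *v \<xi>') /\<^sub>R \<sigma>))"
  define a where "a = (u /\<^sub>R \<sigma>, - (v /\<^sub>R \<sigma>))"
  note Pi_Lip = norm_closest_point_diff_le[OF nonpos_mats_props, folded Pi_minus_def]
  note P_Lip = norm_closest_point_diff_le[OF P]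
  have p_diff: "p x - p y = (Pi_minus (fst x) - Pi_minus (fst y), closest_point P (snd x) - closest_point P (snd y))"
    for x y by (simp add: p_def)

  have linS: "linear S"
    by (rule linearI)
      (simp_all add: S_def matrix_vector_right_distrib matrix_vector_mult_scaleR algebra_simps)
  have linT: "linear T"
    by (rule linearI)
      (simp_all add: T_def linear_add[OF linear_A_op] linear_add[OF linear_B_op]
        linear_scale[OF linear_A_op] linear_scale[OF linear_B_op] algebra_simps)
  have adjT: "adjoint T = (\<lambda>y. (- adjoint A_op (fst y), - adjoint (B_op X) (fst y) + snd y))"
    by (rule adjoint_unique)
      (simp add: T_def inner_prod_def inner_diff_left inner_diff_right inner_add_right adjoint_works[OF linear_A_op]
        adjoint_works[OF linear_B_op])
  obtain m2 where m2: "m2 > 0" "\<And>x. m2 * (norm x)\<^sup>2 \<le> (H2 *v x) \<bullet> x"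
    using pos_def_mat_lower_bound[OF H2] by blast
  obtain m1 where m1: "m1 > 0" "\<And>x. m1 * (norm x)\<^sup>2 \<le> (H1 *v x) \<bullet> x"
    using pos_def_mat_lower_bound[OF H1] by blast
  \<comment> \<open>The two blocks are bounded below by \<open>m1\<close> / \<open>\<sigma>\<close>
    and \<open>m2\<close> / \<open>\<sigma>\<close>; the identity in the first block adds a
    nonnegative term.\<close>
  define m where "m = min m1 m2 / \<sigma>"
  have m: "m > 0" using m1 m2 \<sigma> by (simp add: m_def)
  have S_pos: "m * (norm z)\<^sup>2 \<le> S z \<bullet> z" for z
  proof -
    have norm2: "(norm z)\<^sup>2 = (norm (fst z))\<^sup>2 + (norm (snd z))\<^sup>2"
      by (simp add: norm_prod_def)
    have "min m1 m2 * (norm (fst z))\<^sup>2 \<le> (H1 *v fst z) \<bullet> fst z"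
      by (rule order_trans[OF mult_right_mono m1(2)]) auto
    moreover have "min m1 m2 * (norm (snd z))\<^sup>2 \<le> (H2 *v snd z) \<bullet> snd z"
      by (rule order_trans[OF mult_right_mono m2(2)]) auto
    ultimately have "min m1 m2 * (norm z)\<^sup>2 \<le> (H1 *v fst z) \<bullet> fst z + (H2 *v snd z) \<bullet> snd z"
      unfolding norm2 distrib_left by (rule add_mono)
    then have "m * (norm z)\<^sup>2 \<le> ((H1 *v fst z) \<bullet> fst z + (H2 *v snd z) \<bullet> snd z) / \<sigma>"
      using \<sigma> by (simp add: m_def divide_right_mono)
    also have "\<dots> \<le> S z \<bullet> z"
      using \<sigma> by (simp add: S_def inner_prod_def inner_add_left divide_inverse algebra_simps)
    finally show ?thesis .
  qed

  have deriv: "GDERIV ?\<Phi> z :> S z + c + \<sigma> *\<^sub>R adjoint T (T z + a - p (T z + a))" for z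
  proof -
    let ?w = "\<lambda>z. - A_op (fst z) - B_op X (snd z) + u /\<^sub>R \<sigma>" and ?q = "\<lambda>z. snd z - v /\<^sub>R \<sigma>"
    have blA: "bounded_linear A_op" and blB: "bounded_linear (B_op X)"
      using linear_A_op linear_B_op linear_conv_bounded_linear by auto
    have blH: "bounded_linear (\<lambda>x. H *v x)" for H :: "real^'k^'k"
      by (simp flip: linear_conv_bounded_linear)
    \<comment> \<open>Symmetry of \<open>H\<close> merges the two product rule terms. A general
      linear \<open>r\<close> allows one statement for both the \<open>fst\<close> and
      \<open>snd\<close> quadratics.\<close>
    have quad: "((\<lambda>z. (H *v (r z - b)) \<bullet> (r z - b)) has_derivative (\<lambda>h. 2 * (r h \<bullet> (H *v (r z - b))))) (at z)"
      if H: "pos_def_mat H" and r: "bounded_linear r"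
      for H :: "real^'k^'k" and r :: "(real^'n) \<times> (real^('n \<times> 'd)) \<Rightarrow> real^'k" and b
    proof -
      have 1: "((\<lambda>z. r z - b) has_derivative r) (at z)"
        using bounded_linear_imp_has_derivative[OF r] has_derivative_diff[OF _ has_derivative_const[of b]]
        by fastforce
      have 2: "((\<lambda>z. H *v (r z - b)) has_derivative (\<lambda>h. H *v r h)) (at z)"
        by (rule bounded_linear.has_derivative[OF blH 1])
      show ?thesis
        using has_derivative_inner[OF 2 1]
        by (rule has_derivative_eq_rhs) (simp add: fun_eq_iff pos_def_mat_sym[OF H] inner_commute)
    qed
    have d1: "((\<lambda>z. (norm (fst z - Y))\<^sup>2) has_derivative (\<lambda>h. 2 * (fst h \<bullet> (fst z - Y)))) (at z)"
      unfolding power2_norm_eq_inner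
      by (auto intro!: derivative_eq_intros simp: inner_commute)
    have w: "(?w has_derivative (\<lambda>h. - A_op (fst h) - B_op X (snd h))) (at z)"
      by (auto intro!: derivative_eq_intros bounded_linear.has_derivative[OF blA] bounded_linear.has_derivative[OF blB])
    have q: "(?q has_derivative snd) (at z)"
      by (auto intro!: derivative_eq_intros)
    \<comment> \<open>Each envelope is half a squared distance, so its gradient is the residual of
      the projection, composed here with an affine map.\<close>
    have d2: "((\<lambda>z. moreau_env (p_fun D) (?q z)) has_derivative (\<lambda>h. snd h \<bullet> ?\<rho> (?q z))) (at z)"
      unfolding p_fun_P moreau_env_indicator_ext[OF P]
      by (rule has_derivative_compose[OF q GDERIV_half_sqdist_closest_point[OF P, unfolded gderiv_def]])
    have d3: "((\<lambda>z. moreau_env (indicator_ext nonpos_mats) (?w z))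
        has_derivative (\<lambda>h. (- A_op (fst h) - B_op X (snd h)) \<bullet> ?\<pi> (?w z))) (at z)"
      unfolding moreau_env_indicator_ext[OF nonpos_mats_props] Pi_minus_def
      by (rule has_derivative_compose[OF w GDERIV_half_sqdist_closest_point[OF nonpos_mats_props, unfolded gderiv_def]])
    have Phi_eq: "?\<Phi> = (\<lambda>z. 1/2 * (norm (fst z - Y))\<^sup>2 + \<sigma> * moreau_env (p_fun D) (?q z)
        + \<sigma> * moreau_env (indicator_ext nonpos_mats) (?w z) - 1/(2*\<sigma>) * (norm u)\<^sup>2 - 1/(2*\<sigma>) * (norm v)\<^sup>2
        + 1/(2*\<sigma>) * ((H1 *v (fst z - \<theta>')) \<bullet> (fst z - \<theta>')) + 1/(2*\<sigma>) * ((H2 *v (snd z - \<xi>')) \<bullet> (snd z - \<xi>')))"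
      by (simp add: Phi_def fun_eq_iff norm_mat_power2[OF H1] norm_mat_power2[OF H2])
    have "(?\<Phi> has_derivative (\<lambda>h. 1/2 * (2 * (fst h \<bullet> (fst z - Y))) + \<sigma> * (snd h \<bullet> ?\<rho> (?q z))
        + \<sigma> * ((- A_op (fst h) - B_op X (snd h)) \<bullet> ?\<pi> (?w z)) - 0 - 0
        + 1/(2*\<sigma>) * (2 * (fst h \<bullet> (H1 *v (fst z - \<theta>')))) + 1/(2*\<sigma>) * (2 * (snd h \<bullet> (H2 *v (snd z - \<xi>')))))) (at z)"
      unfolding Phi_eq
      by (intro has_derivative_add has_derivative_diff has_derivative_mult_right has_derivative_const
          d1 d2 d3 quad H1 H2 bounded_linear_fst bounded_linear_snd)
    then show ?thesis
      unfolding gderiv_def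
    proof (rule has_derivative_eq_rhs, intro ext)
      fix h :: "(real^'n) \<times> (real^('n \<times> 'd))"
      have Tz: "T z + a - p (T z + a) = (?\<pi> (?w z), ?\<rho> (?q z))"
        by (simp add: T_def a_def p_def)
      have "h \<bullet> adjoint T (?\<pi> (?w z), ?\<rho> (?q z))
          = (- A_op (fst h) - B_op X (snd h)) \<bullet> ?\<pi> (?w z) + snd h \<bullet> ?\<rho> (?q z)"
        unfolding adjoint_works[OF linT] by (simp add: T_def)
      moreover have "h \<bullet> (S z + c) = fst h \<bullet> (fst z - Y) + (fst h \<bullet> (H1 *v (fst z - \<theta>'))) / \<sigma>
          + (snd h \<bullet> (H2 *v (snd z - \<xi>'))) / \<sigma>"
        by (simp add: S_def c_def inner_prod_def inner_add_right inner_diff_right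
            matrix_vector_mult_diff_distrib divide_inverse algebra_simps)
      ultimately show "1/2 * (2 * (fst h \<bullet> (fst z - Y))) + \<sigma> * (snd h \<bullet> ?\<rho> (?q z))
        + \<sigma> * ((- A_op (fst h) - B_op X (snd h)) \<bullet> ?\<pi> (?w z)) - 0 - 0
        + 1/(2*\<sigma>) * (2 * (fst h \<bullet> (H1 *v (fst z - \<theta>')))) + 1/(2*\<sigma>) * (2 * (snd h \<bullet> (H2 *v (snd z - \<xi>'))))
        = h \<bullet> (S z + c + \<sigma> *\<^sub>R adjoint T (T z + a - p (T z + a)))"
        unfolding Tz inner_add_right[of h "S z + c"] inner_scaleR_right by (simp add: distrib_left)
    qed
  qed

  have fst_lim: "filterlim fst (nhds 0) (nhds (0 :: (real^'n^'n) \<times> (real^('n \<times> 'd))))"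
    and snd_lim: "filterlim snd (nhds 0) (nhds (0 :: (real^'n^'n) \<times> (real^('n \<times> 'd))))"
    using tendsto_fst[OF filterlim_ident, of 0] tendsto_snd[OF filterlim_ident, of 0] by simp_all

  have norm_snd: "norm (snd h) \<le> norm h" for h :: "(real^'n^'n) \<times> (real^('n \<times> 'd))"
    by (cases h) (simp add: norm_snd_le)

  have "\<exists>L. semismooth_newton ?\<Phi> (\<lambda>x. S x + c + \<sigma> *\<^sub>R adjoint T (T x + a - p (T x + a)))
    (\<lambda>x. {\<lambda>h. S h + \<sigma> *\<^sub>R adjoint T (T h - V (T h)) | V. V \<in> U (T x + a)}) m L"
  proof (rule semismooth_newton_composite[OF linS _ S_pos m linT \<sigma> deriv])
    show "S x \<bullet> y = x \<bullet> S y" for x y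
      by (simp add: S_def inner_prod_def inner_add_left inner_add_right pos_def_mat_sym[OF H1] pos_def_mat_sym[OF H2])
    show "norm (p x - p y) \<le> norm (x - y)" for x y
    proof -
      have "norm (p x - p y) \<le> norm (fst x - fst y, snd x - snd y)"
        unfolding p_diff by (rule norm_Pair_mono[OF Pi_Lip P_Lip])
      also have "(fst x - fst y, snd x - snd y) = x - y"
        by (simp add: prod_eq_iff)
      finally show ?thesis .
    qed
    fix V x assume "V \<in> U x"
    then obtain V1 W where V1: "V1 \<in> clarke_jacobian Pi_minus (fst x)" and W: "W \<in> clarke_jacobian (closest_point P) (snd x)"
      and V: "V = (\<lambda>h. (blinfun_apply V1 (fst h), blinfun_apply W (snd h)))"
      unfolding U_def by blast
    note V1' = clarke_jacobian_closest_point[OF nonpos_mats_props V1[unfolded Pi_minus_def]]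
      and W' = clarke_jacobian_closest_point[OF P W]
    show "linear V"
      unfolding V by (rule linearI) (simp_all add: blinfun.add_right blinfun.scaleR_right)
    show "V y \<bullet> z = y \<bullet> V z" for y z
      by (simp add: V inner_prod_def V1'(1) W'(1))
    show "norm (V y) \<le> norm y" for y
      unfolding V by (rule order_trans[OF norm_Pair_mono[OF V1'(2) W'(2)]]) simp
  next
    fix x :: "(real^'n^'n) \<times> (real^('n \<times> 'd))"
    obtain C where C: "\<forall>\<^sub>F h in at 0. \<forall>W \<in> clarke_jacobian (closest_point P) (snd x + h).
        norm (closest_point P (snd x + h) - closest_point P (snd x) - blinfun_apply W h) \<le> C * (norm h)\<^sup>2"
      using ss by blast
    \<comment> \<open>At zero displacement both sides vanish, so the punctured neighbourhood can be
      filled in.\<close>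
    then have C': "\<forall>\<^sub>F h in nhds 0. \<forall>W \<in> clarke_jacobian (closest_point P) (snd x + h).
        norm (closest_point P (snd x + h) - closest_point P (snd x) - blinfun_apply W h) \<le> C * (norm h)\<^sup>2"
      by (simp add: eventually_nhds_conv_at blinfun.zero_right)
    have "\<forall>\<^sub>F h in nhds 0. \<forall>V\<in>U (x + h). norm (p (x + h) - p x - V h) \<le> \<bar>C\<bar> * (norm h)\<^sup>2"
      using fst_lim[unfolded filterlim_iff, rule_format, OF Pi_minus_semismooth_exact[of "fst x"]]
        snd_lim[unfolded filterlim_iff, rule_format, OF C']
    proof eventually_elim
      case (elim h)
      show ?case
      proof
        fix V assume "V \<in> U (x + h)"
        then obtain V1 W where V1: "V1 \<in> clarke_jacobian Pi_minus (fst x + fst h)"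
          and W: "W \<in> clarke_jacobian (closest_point P) (snd x + snd h)"
          and V: "V = (\<lambda>h. (blinfun_apply V1 (fst h), blinfun_apply W (snd h)))"
          unfolding U_def by auto
        \<comment> \<open>The matrix component is exact, so the whole remainder comes from the
          proximal part.\<close>
        have "p (x + h) - p x - V h
            = (0, closest_point P (snd x + snd h) - closest_point P (snd x) - blinfun_apply W (snd h))"
          using elim(1) V1 by (simp add: p_def V)
        then have "norm (p (x + h) - p x - V h) \<le> C * (norm (snd h))\<^sup>2"
          using elim(2) W by (simp add: norm_Pair)
        also have "\<dots> \<le> \<bar>C\<bar> * (norm h)\<^sup>2"
          by (intro mult_mono power_mono norm_snd) auto
        finally show "norm (p (x + h) - p x - V h) \<le> \<bar>C\<bar> * (norm h)\<^sup>2" .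
      qed
    qed
    then show "\<exists>C. \<forall>\<^sub>F h in nhds 0. \<forall>V\<in>U (x + h). norm (p (x + h) - p x - V h) \<le> C * (norm h)\<^sup>2"
      by blast
  next
    fix x :: "(real^'n^'n) \<times> (real^('n \<times> 'd))" and e :: real assume e: "e > 0"
    \<comment> \<open>The projection is nonexpansive everywhere, so any radius would do.\<close>
    have Lip: "1-lipschitz_on (ball (snd x) 1) (closest_point P)"
      using closest_point_lipschitz[OF P] by (intro lipschitz_onI) auto
    have dd: "directionally_differentiable_at (closest_point P) (snd x)"
      using ss by blast
    show "\<forall>\<^sub>F h in nhds 0. \<forall>t\<in>{0..1}. norm (p (x + t *\<^sub>R h) - p x - t *\<^sub>R (p (x + h) - p x)) \<le> e * norm h"
      using fst_lim[unfolded filterlim_iff, rule_format, OF Pi_minus_radial_exact[of "fst x"]]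
        snd_lim[unfolded filterlim_iff, rule_format, OF directionally_differentiable_radial[OF Lip zero_less_one dd e]]
    proof eventually_elim
      case (elim h)
      show ?case
      proof
        fix t :: real assume t: "t \<in> {0..1}"
        let ?r = "closest_point P (snd x + t *\<^sub>R snd h) - closest_point P (snd x)
            - t *\<^sub>R (closest_point P (snd x + snd h) - closest_point P (snd x))"
        have "p (x + t *\<^sub>R h) - p x - t *\<^sub>R (p (x + h) - p x) = (0, ?r)"
          using elim(1) t by (simp add: p_def)
        then have "norm (p (x + t *\<^sub>R h) - p x - t *\<^sub>R (p (x + h) - p x)) = norm ?r"
          by (simp add: norm_Pair)
        also have "\<dots> \<le> e * norm (snd h)"
          using elim(2) t by blast
        also have "\<dots> \<le> e * norm h"
          using e by (intro mult_left_mono norm_snd) auto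
        finally show "norm (p (x + t *\<^sub>R h) - p x - t *\<^sub>R (p (x + h) - p x)) \<le> e * norm h" .
      qed
    qed
  qed
  then obtain L where newton: "semismooth_newton ?\<Phi> (\<lambda>x. S x + c + \<sigma> *\<^sub>R adjoint T (T x + a - p (T x + a)))
    (\<lambda>x. {\<lambda>h. S h + \<sigma> *\<^sub>R adjoint T (T h - V (T h)) | V. V \<in> U (T x + a)}) m L"
    by blast

  \<comment> \<open>The minus signs in the first component of \<open>T\<close> reappear in its
    adjoint and cancel, which reproduces the operator of the algorithm.\<close>
  have hess: "hess_op X \<sigma> H1 H2 V W = (\<lambda>h. S h + \<sigma> *\<^sub>R adjoint T (T h - (blinfun_apply V (fst (T h)), blinfun_apply W (snd (T h)))))"
    for V W
  proof
    fix h :: "(real^'n) \<times> (real^('n \<times> 'd))"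
    define M where "M = A_op (fst h) + B_op X (snd h)"
    define R where "R = M - blinfun_apply V M"
    have "T h = (- M, snd h)"
      by (simp add: T_def M_def)
    then have Th: "T h - (blinfun_apply V (fst (T h)), blinfun_apply W (snd (T h))) = (- R, snd h - blinfun_apply W (snd h))"
      by (simp add: R_def blinfun.minus_right)
    have neg: "adjoint A_op (- R) = - adjoint A_op R" "adjoint (B_op X) (- R) = - adjoint (B_op X) R"
      by (intro linear_neg adjoint_linear linear_A_op linear_B_op)+
    have "hess_op X \<sigma> H1 H2 V W h = (\<sigma> *\<^sub>R adjoint A_op R + (fst h + (H1 *v fst h) /\<^sub>R \<sigma>),
        \<sigma> *\<^sub>R adjoint (B_op X) R + (\<sigma> *\<^sub>R (snd h - blinfun_apply W (snd h)) + (H2 *v snd h) /\<^sub>R \<sigma>))"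
      by (simp add: hess_op_def case_prod_beta Let_def M_def R_def)
    also have "\<dots> = S h + \<sigma> *\<^sub>R adjoint T (- R, snd h - blinfun_apply W (snd h))"
      by (simp add: adjT S_def neg algebra_simps)
    finally show "hess_op X \<sigma> H1 H2 V W h
        = S h + \<sigma> *\<^sub>R adjoint T (T h - (blinfun_apply V (fst (T h)), blinfun_apply W (snd (T h))))"
      unfolding Th .
  qed
  \<comment> \<open>The set of Hessians used by the algorithm coincides with the family of the
    abstract method, so the given sequence is one of its sequences.\<close>
  have "gen_hess_Phi X D \<sigma> u v H1 H2
      = (\<lambda>x. {\<lambda>h. S h + \<sigma> *\<^sub>R adjoint T (T h - V (T h)) | V. V \<in> U (T x + a)})"
  proof
    fix z
    have "fst (T z + a) = - A_op (fst z) - B_op X (snd z) + u /\<^sub>R \<sigma>" "snd (T z + a) = snd z - v /\<^sub>R \<sigma>"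
      by (simp_all add: T_def a_def)
    then have U_eq: "U (T z + a) = {\<lambda>h. (blinfun_apply V (fst h), blinfun_apply W (snd h)) | V W.
        V \<in> clarke_jacobian Pi_minus (- A_op (fst z) - B_op X (snd z) + u /\<^sub>R \<sigma>)
      \<and> W \<in> clarke_jacobian (closest_point P) (snd z - v /\<^sub>R \<sigma>)}"
      by (simp only: U_def)
    show "gen_hess_Phi X D \<sigma> u v H1 H2 z = {\<lambda>h. S h + \<sigma> *\<^sub>R adjoint T (T h - V (T h)) | V. V \<in> U (T z + a)}"
      (is "_ = ?R")
    proof (intro set_eqI iffI)
      fix H assume "H \<in> gen_hess_Phi X D \<sigma> u v H1 H2 z"
      then obtain V W where VW: "V \<in> clarke_jacobian Pi_minus (- A_op (fst z) - B_op X (snd z) + u /\<^sub>R \<sigma>)"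
          "W \<in> clarke_jacobian (closest_point P) (snd z - v /\<^sub>R \<sigma>)" and H: "H = hess_op X \<sigma> H1 H2 V W"
        unfolding gen_hess_Phi_def Prox_P case_prod_beta by blast
      have U_mem: "(\<lambda>h. (blinfun_apply V (fst h), blinfun_apply W (snd h))) \<in> U (T z + a)"
        unfolding U_eq using VW by blast
      show "H \<in> ?R"
        unfolding H hess
        by (intro CollectI exI[of _ "\<lambda>h. (blinfun_apply V (fst h), blinfun_apply W (snd h))"] conjI refl U_mem)
    next
      fix H assume "H \<in> ?R"
      then obtain V where "V \<in> U (T z + a)" and H: "H = (\<lambda>h. S h + \<sigma> *\<^sub>R adjoint T (T h - V (T h)))"
        by blast
      then obtain V1 W where "V1 \<in> clarke_jacobian Pi_minus (- A_op (fst z) - B_op X (snd z) + u /\<^sub>R \<sigma>)"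
          "W \<in> clarke_jacobian (closest_point P) (snd z - v /\<^sub>R \<sigma>)"
          and V: "V = (\<lambda>h. (blinfun_apply V1 (fst h), blinfun_apply W (snd h)))"
        unfolding U_eq by blast
      moreover have "H = hess_op X \<sigma> H1 H2 V1 W"
        unfolding H V hess ..
      ultimately show "H \<in> gen_hess_Phi X D \<sigma> u v H1 H2 z"
        unfolding gen_hess_Phi_def Prox_P case_prod_beta by blast
    qed
  qed
  then have seq: "ssn_sequence ?\<Phi> (\<lambda>x. {\<lambda>h. S h + \<sigma> *\<^sub>R adjoint T (T h - V (T h)) | V. V \<in> U (T x + a)})
      \<gamma> \<tau> \<delta> \<mu> (\<lambda>j. (\<theta> j, \<xi> j))"
    using assms(10) by simp
  have par: "0 < \<gamma>" "\<gamma> < 1" "0 < \<tau>" "\<tau> \<le> 1" "0 < \<delta>" "\<delta> < 1" "0 < \<mu>" "\<mu> < 1/2"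
    using assms(5-8) by auto
  obtain zb where "\<forall>y. is_arg_min ?\<Phi> (\<lambda>_. True) y \<longleftrightarrow> y = zb" "(\<lambda>j. (\<theta> j, \<xi> j)) \<longlonglongrightarrow> zb"
    "(\<lambda>j. norm ((\<theta> (Suc j), \<xi> (Suc j)) - zb)) \<in> O(\<lambda>j. norm ((\<theta> j, \<xi> j) - zb) powr (1 + \<tau>))"
    using semismooth_newton.ssn_superlinear[OF newton par seq] by blast
  then show ?thesis
    by (cases zb) blast
qed

end
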